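(* Consider the auxiliary system and the augmented system defined in the context, and assume that all eigenvalues of $S$ are on the imaginary axis. (i) Suppose a static state feedback control law $u(t)=\tilde K_xx(t-\tau_{com})+\tilde K_zz(t)$ stabilizes the nominal plant of the augmented system. Then the dynamic state feedback control law $$u(t)=\tilde K_xx(t-\tau_{com})+\tilde K_zz(t),\qquad \dot z(t)=\tilde G_1z(t)+\tilde G_2e_v(t-\tau_{com})$$ solves the robust output regulation problem of the auxiliary system. (ii) Suppose a dynamic output feedback control law $$u(t)=\tilde K_1z(t)+\tilde K_2\xi(t),\qquad \dot\xi(t)=\tilde S_1\xi(t)+\tilde S_2e_v(t-\tau_{com})+\tilde S_3\zeta(t-\tau),\qquad \zeta=\mathrm{col}(z,\xi),$$ with $\xi(t)\in\mathbb R^{Nn}$, stabilizes the nominal plant of the augmented system. Then the dynamic output feedback control law $$u(t)=\tilde K_1z(t)+\tilde K_2\xi(t),\quad \dot z(t)=\tilde G_1z(t)+\tilde G_2e_v(t-\tau_{com}),\quad \dot\xi(t)=\tilde S_1\xi(t)+\tilde S_2e_v(t-\tau_{com})+\tilde S_3\zeta(t-\tau)$$ solves the robust output regulation problem of the auxiliary system. Moreover, if in addition the digraph $\bar{\mathcal G}$ contains a directed spanning tree with node $0$ as the root, then in case (i), respectively (ii), the resulting control law also solves the cooperative robust output regulation problem of the original multi-agent plant, in the sense that the nominal closed-loop system with $v=0$ is exponentially stable and there is an open neighborhood $W$ of $w=0$ such that, for all $w\in W$ and all initial conditions, $\lim_{t\to\infty}e_i(t)=0$, $i=1,\dots,N$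.
   Context: Original plant, $i=1,\dots,N$: $\dot x_i(t)=\bar A_ix_i(t)+\bar B_iu_i(t-\tau_{con})+\bar E_iv(t)$, $y_i=\bar C_ix_i$, with $x_i\in\mathbb R^n$, $u_i\in\mathbb R^m$, $y_i\in\mathbb R^p$; exosystem $\dot v=Sv$, $v(0)=v_0\in\mathbb R^q$, $S\in\mathbb R^{q\times q}$; $y_0=-Fv$, $F\in\mathbb R^{p\times q}$; $e_i=y_i-y_0=\bar C_ix_i+Fv$. Delays: $\tau_{con},\tau_{com}\ge0$, $\tau=\tau_{con}+\tau_{com}$. Uncertainty: $\bar A_i=A_i+\delta_iA$, $\bar B_i=B_i+\delta_iB$, $\bar E_i=E_i+\delta_iE$, $\bar C_i=C_i+\delta_iC$ with nominal parts $A_i,B_i,E_i,C_i$ and constant perturbations; $w$ is the vector of all entries of all perturbations, and nominal means $w=0$. Digraph: $\bar{\mathcal G}$ has node set $\{0,1,\dots,N\}$ with node $0$ the exosystem and no edge entering node $0$; weighted adjacency matrix $[a_{ij}]$ with $a_{ii}=0$, $a_{ij}>0$ if $(j,i)$ is an edge, and $a_{ij}=0$ otherwise. $\Delta=\mathrm{diag}(a_{10},\dots,a_{N0})$, and $H\in\mathbb R^{N\times N}$ has entries $H_{ii}=\sum_{j=0}^Na_{ij}$, $H_{ij}=-a_{ij}$ for $i\ne j$ (so $H\mathbf 1_N=\Delta\mathbf 1_N$, with $\mathbf 1_N$ the all-ones column vector). Stacked notation: $x=\mathrm{col}(x_1,\dots,x_N)$, $u=\mathrm{col}(u_1,\dots,u_N)$,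 $\tilde A=\text{block diag}(\bar A_1,\dots,\bar A_N)$, $\tilde B=\text{block diag}(\bar B_1,\dots,\bar B_N)$, $\tilde E=(\bar E_1^T,\dots,\bar E_N^T)^T$, $\tilde C=(H\otimes I_p)\,\text{block diag}(\bar C_1,\dots,\bar C_N)$, $\tilde F=(\Delta\mathbf 1_N)\otimes F$, $\tilde G_1=I_N\otimes G_1$, $\tilde G_2=I_N\otimes G_2$. $(G_1,G_2)$ is a minimal $p$-copy internal model of $S$: $G_1=\text{block diag}(\beta,\dots,\beta)$, $G_2=\text{block diag}(\sigma,\dots,\sigma)$ ($p$ copies each), where $\beta$ is a real square matrix whose characteristic polynomial equals the minimal polynomial of $S$, and $\sigma$ is a real column vector with $(\beta,\sigma)$ controllable. $n_z$ is the size of $G_1$, and $z(t)\in\mathbb R^{Nn_z}$. Auxiliary system: $\dot x(t)=\tilde Ax(t)+\tilde Bu(t-\tau_{con})+\tilde Ev(t)$, $\dot v(t)=Sv(t)$, $e_v(t)=\tilde Cx(t)+\tilde Fv(t)$, $t\ge0$. Augmented system: the auxiliary system together with $\dot z(t)=\tilde G_1z(t)+\tilde G_2e_v(t-\tau_{com})$. Its nominal plant is this system with $w=0$ and $v=0$. A control law stabilizes it if the resulting closed-loop linear delay system is exponentially stable. A control law solves the robust output regulation problem of the auxiliary system if (1) the nominal ($w=0$) closed-loop system is exponentially stable when $v=0$; (2) there is an open neighborhood $W$ of $w=0$ such that, for every $w\in W$ and all initial conditions, $\lim_{t\to\infty}e_v(t)=0$. $\tilde K_x,\tilde K_z,\tilde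 K_1,\tilde K_2,\tilde S_1,\tilde S_2,\tilde S_3$ are constant real matrices of appropriate dimensions. Initial conditions of $x$ and the controller states are arbitrary continuous functions on $[-\tau,0]$, used to evaluate delayed terms at negative times (with $v(t)=e^{St}v_0$ for all $t$). *)

theory Defs
  imports "HOL-Analysis.Analysis" "HOL-Computational_Algebra.Polynomial"
begin

section \<open>Matrix notions\<close>

text \<open>
  Stacked vectors and block matrices are indexed by pairs (block index, index within the block);
  \<open>real^'c^'r\<close> is the type of matrices with rows indexed by \<open>'r\<close> and columns indexed by \<open>'c\<close>.
\<close>

definition kron :: "real^'c^'r \<Rightarrow> real^'d^'s \<Rightarrow> real^('c::finite \<times> 'd::finite)^('r::finite \<times> 's::finite)"
    (infixl \<open>\<otimes>\<^sub>k\<close> 75) where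
  "A \<otimes>\<^sub>k B = (\<chi> r c. A $ fst r $ fst c * B $ snd r $ snd c)"

text \<open>The case in which the left factor is a column vector.\<close>
definition vec_kron :: "real^'r \<Rightarrow> real^'d^'s \<Rightarrow> real^'d::finite^('r::finite \<times> 's::finite)"
    (infixl \<open>\<otimes>\<^sub>v\<close> 75) where
  "a \<otimes>\<^sub>v B = (\<chi> r c. a $ fst r * B $ snd r $ c)"

definition block_diag :: "('k \<Rightarrow> real^'c^'r) \<Rightarrow> real^('k::finite \<times> 'c::finite)^('k \<times> 'r::finite)" where
  "block_diag M = (\<chi> r c. if fst r = fst c then M (fst r) $ snd r $ snd c else 0)"

text \<open>\<open>block_diag_vec s\<close> is block diagonal with the column vectors \<open>s k\<close> as blocks; since each
  block has one column, the columns are indexed by the block index alone.\<close>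
definition block_diag_vec :: "('k \<Rightarrow> real^'r) \<Rightarrow> real^'k^('k::finite \<times> 'r::finite)" where
  "block_diag_vec s = (\<chi> r k. if fst r = k then s k $ snd r else 0)"

definition block_column :: "('k \<Rightarrow> real^'c^'r) \<Rightarrow> real^'c::finite^('k::finite \<times> 'r::finite)" where
  "block_column M = (\<chi> r c. M (fst r) $ snd r $ c)"

definition col :: "('k \<Rightarrow> real \<Rightarrow> real^'r) \<Rightarrow> real \<Rightarrow> real^('k::finite \<times> 'r::finite)" where
  "col x t = (\<chi> r. x (fst r) t $ snd r)"

definition col2 :: "real^'a \<Rightarrow> real^'b \<Rightarrow> real^('a::finite + 'b::finite)" where
  "col2 y z = (\<chi> r. case r of Inl a \<Rightarrow> y $ a | Inr b \<Rightarrow> z $ b)"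

definition matrix_power :: "'a::semiring_1^'n^'n \<Rightarrow> nat \<Rightarrow> 'a^'n^'n::finite" where
  "matrix_power A k = (((**) A) ^^ k) (mat 1)"

definition poly_matrix :: "real poly \<Rightarrow> real^'n^'n \<Rightarrow> real^'n^'n::finite" where
  "poly_matrix f A = (\<Sum>k\<le>degree f. coeff f k *\<^sub>R matrix_power A k)"

definition char_poly :: "real^'n^'n \<Rightarrow> real poly" where
  "char_poly A = det (\<chi> i j :: 'n::finite. (if i = j then [:0, 1:] else 0) - [:A $ i $ j:])"

definition is_minimal_poly :: "real poly \<Rightarrow> real^'n^'n::finite \<Rightarrow> bool" where
  "is_minimal_poly f A \<longleftrightarrow>
     lead_coeff f = 1 \<and> poly_matrix f A = 0 \<and>
     (\<forall>g. g \<noteq> 0 \<and> poly_matrix g A = 0 \<longrightarrow> degree f \<le> degree g)"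

text \<open>The matrix with columns \<open>b, A b, \<dots>, A\<^sup>n\<^sup>-\<^sup>1 b\<close> has rank \<open>n\<close>.\<close>
definition controllable :: "real^'n^'n \<Rightarrow> real^'n::finite \<Rightarrow> bool" where
  "controllable A b \<longleftrightarrow> dim {matrix_power A k *v b | k. k < CARD('n)} = CARD('n)"

definition complex_eigenvalue :: "real^'n^'n::finite \<Rightarrow> complex \<Rightarrow> bool" where
  "complex_eigenvalue A l \<longleftrightarrow>
     (\<exists>y. y \<noteq> 0 \<and> (\<chi> i j. complex_of_real (A $ i $ j)) *v y = l *s y)"

definition minimal_p_copy_internal_model ::
    "real^'q^'q::finite \<Rightarrow> real^('p \<times> 'b)^('p \<times> 'b) \<Rightarrow> real^'p^('p::finite \<times> 'b::finite) \<Rightarrow> bool" where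
  "minimal_p_copy_internal_model S G1 G2 \<longleftrightarrow>
     (\<exists>(\<beta>::real^'b^'b) (\<sigma>::real^'b).
        is_minimal_poly (char_poly \<beta>) S \<and> controllable \<beta> \<sigma> \<and>
        G1 = block_diag (\<lambda>_. \<beta>) \<and> G2 = block_diag_vec (\<lambda>_. \<sigma>))"


section \<open>Plant data\<close>

text \<open>
  The agents are the elements of \<open>'N\<close>; the graph has node set \<open>'N option\<close>, with \<open>None\<close> the
  exosystem (node 0). A pair \<open>(j, i)\<close> in \<open>edges\<close> is an edge from \<open>j\<close> to \<open>i\<close>, and
  \<open>adj $ i $ j\<close> is its weight.
\<close>
record ('N::finite, 'n::finite, 'm::finite, 'p::finite, 'q::finite) plant =
  nomA :: "real^'n^'n^'N"
  nomB :: "real^'m^'n^'N"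
  nomE :: "real^'q^'n^'N"
  nomC :: "real^'n^'p^'N"
  exoS :: "real^'q^'q"
  refF :: "real^'q^'p"
  edges :: "('N option \<times> 'N option) set"
  adj :: "real^('N option)^('N option)"
  tcon :: real
  tcom :: real

text \<open>The uncertainty vector \<open>w\<close>, grouped into the perturbations of all \<open>A\<^sub>i\<close>, \<open>B\<^sub>i\<close>, \<open>E\<^sub>i\<close>, \<open>C\<^sub>i\<close>;
  the topology of this type is that of the Euclidean space of all entries.\<close>
type_synonym ('N, 'n, 'm, 'p, 'q) pert =
  "(real^'n^'n^'N) \<times> (real^'m^'n^'N) \<times> (real^'q^'n^'N) \<times> (real^'n^'p^'N)"

definition tau :: "('N::finite, 'n::finite, 'm::finite, 'p::finite, 'q::finite) plant \<Rightarrow> real" where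
  "tau P = tcon P + tcom P"

definition barA :: "('N::finite, 'n::finite, 'm::finite, 'p::finite, 'q::finite) plant \<Rightarrow>
    ('N, 'n, 'm, 'p, 'q) pert \<Rightarrow> 'N \<Rightarrow> real^'n^'n" where
  "barA P w i = nomA P $ i + fst w $ i"

definition barB :: "('N::finite, 'n::finite, 'm::finite, 'p::finite, 'q::finite) plant \<Rightarrow>
    ('N, 'n, 'm, 'p, 'q) pert \<Rightarrow> 'N \<Rightarrow> real^'m^'n" where
  "barB P w i = nomB P $ i + fst (snd w) $ i"

definition barE :: "('N::finite, 'n::finite, 'm::finite, 'p::finite, 'q::finite) plant \<Rightarrow>
    ('N, 'n, 'm, 'p, 'q) pert \<Rightarrow> 'N \<Rightarrow> real^'q^'n" where
  "barE P w i = nomE P $ i + fst (snd (snd w)) $ i"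

definition barC :: "('N::finite, 'n::finite, 'm::finite, 'p::finite, 'q::finite) plant \<Rightarrow>
    ('N, 'n, 'm, 'p, 'q) pert \<Rightarrow> 'N \<Rightarrow> real^'n^'p" where
  "barC P w i = nomC P $ i + snd (snd (snd w)) $ i"


section \<open>Communication graph\<close>

definition weighted_digraph ::
    "('N::finite, 'n::finite, 'm::finite, 'p::finite, 'q::finite) plant \<Rightarrow> bool" where
  "weighted_digraph P \<longleftrightarrow>
     (\<forall>j. (j, None) \<notin> edges P) \<and>
     (\<forall>i. adj P $ i $ i = 0) \<and>
     (\<forall>i j. (j, i) \<in> edges P \<longrightarrow> adj P $ i $ j > 0) \<and>
     (\<forall>i j. (j, i) \<notin> edges P \<longrightarrow> adj P $ i $ j = 0)"

definition directed_spanning_tree :: "('v \<times> 'v) set \<Rightarrow> ('v \<times> 'v) set \<Rightarrow> 'v \<Rightarrow> bool" where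
  "directed_spanning_tree G T r \<longleftrightarrow>
     T \<subseteq> G \<and> (\<forall>j. (j, r) \<notin> T) \<and>
     (\<forall>i. i \<noteq> r \<longrightarrow> (\<exists>!j. (j, i) \<in> T)) \<and>
     (\<forall>i. (r, i) \<in> T\<^sup>*)"

definition Delta :: "('N::finite, 'n::finite, 'm::finite, 'p::finite, 'q::finite) plant \<Rightarrow> real^'N^'N" where
  "Delta P = (\<chi> i j. if i = j then adj P $ Some i $ None else 0)"

definition matH :: "('N::finite, 'n::finite, 'm::finite, 'p::finite, 'q::finite) plant \<Rightarrow> real^'N^'N" where
  "matH P = (\<chi> i j. if i = j then (\<Sum>l\<in>UNIV. adj P $ Some i $ l) else - adj P $ Some i $ Some j)"


section \<open>Auxiliary and augmented systems\<close>

definition tilA :: "('N::finite, 'n::finite, 'm::finite, 'p::finite, 'q::finite) plant \<Rightarrow>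
    ('N, 'n, 'm, 'p, 'q) pert \<Rightarrow> real^('N \<times> 'n)^('N \<times> 'n)" where
  "tilA P w = block_diag (barA P w)"

definition tilB :: "('N::finite, 'n::finite, 'm::finite, 'p::finite, 'q::finite) plant \<Rightarrow>
    ('N, 'n, 'm, 'p, 'q) pert \<Rightarrow> real^('N \<times> 'm)^('N \<times> 'n)" where
  "tilB P w = block_diag (barB P w)"

definition tilE :: "('N::finite, 'n::finite, 'm::finite, 'p::finite, 'q::finite) plant \<Rightarrow>
    ('N, 'n, 'm, 'p, 'q) pert \<Rightarrow> real^'q^('N \<times> 'n)" where
  "tilE P w = block_column (barE P w)"

definition tilC :: "('N::finite, 'n::finite, 'm::finite, 'p::finite, 'q::finite) plant \<Rightarrow>
    ('N, 'n, 'm, 'p, 'q) pert \<Rightarrow> real^('N \<times> 'n)^('N \<times> 'p)" where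
  "tilC P w = (matH P \<otimes>\<^sub>k mat 1) ** block_diag (barC P w)"

definition tilF :: "('N::finite, 'n::finite, 'm::finite, 'p::finite, 'q::finite) plant \<Rightarrow>
    real^'q^('N \<times> 'p)" where
  "tilF P = (Delta P *v (\<chi> i. 1)) \<otimes>\<^sub>v refF P"

text \<open>Signals are functions on all of \<open>real\<close>, of which only the values at times \<open>\<ge> -\<tau>\<close> matter;
  at time 0 the derivative of the delayed states is one-sided. The exosystem is solved on all of
  \<open>real\<close>, i.e. \<open>v t = exp (S t) v\<^sub>0\<close> for all \<open>t\<close>.\<close>

definition exosystem :: "('N::finite, 'n::finite, 'm::finite, 'p::finite, 'q::finite) plant \<Rightarrow>
    (real \<Rightarrow> real^'q) \<Rightarrow> bool" where
  "exosystem P v \<longleftrightarrow> (\<forall>t. (v has_vector_derivative exoS P *v v t) (at t))"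

definition error_signal :: "('N::finite, 'n::finite, 'm::finite, 'p::finite, 'q::finite) plant \<Rightarrow>
    ('N, 'n, 'm, 'p, 'q) pert \<Rightarrow> (real \<Rightarrow> real^'q) \<Rightarrow> (real \<Rightarrow> real^('N \<times> 'n)) \<Rightarrow>
    (real \<Rightarrow> real^('N \<times> 'p)) \<Rightarrow> bool" where
  "error_signal P w v x ev \<longleftrightarrow> (\<forall>t\<ge>- tau P. ev t = tilC P w *v x t + tilF P *v v t)"

definition auxiliary_system :: "('N::finite, 'n::finite, 'm::finite, 'p::finite, 'q::finite) plant \<Rightarrow>
    ('N, 'n, 'm, 'p, 'q) pert \<Rightarrow> (real \<Rightarrow> real^'q) \<Rightarrow> (real \<Rightarrow> real^('N \<times> 'n)) \<Rightarrow>
    (real \<Rightarrow> real^('N \<times> 'm)) \<Rightarrow> (real \<Rightarrow> real^('N \<times> 'p)) \<Rightarrow> bool" where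
  "auxiliary_system P w v x u ev \<longleftrightarrow>
     exosystem P v \<and> error_signal P w v x ev \<and> continuous_on {- tau P..0} x \<and>
     (\<forall>t\<ge>0. (x has_vector_derivative
        tilA P w *v x t + tilB P w *v u (t - tcon P) + tilE P w *v v t) (at t within {0..}))"

definition internal_model_dynamics ::
    "('N::finite, 'n::finite, 'm::finite, 'p::finite, 'q::finite) plant \<Rightarrow>
     real^'z^'z \<Rightarrow> real^'p^'z \<Rightarrow> (real \<Rightarrow> real^('N \<times> 'p)) \<Rightarrow> (real \<Rightarrow> real^('N \<times> 'z::finite)) \<Rightarrow> bool" where
  "internal_model_dynamics P G1 G2 ev z \<longleftrightarrow>
     continuous_on {- tau P..0} z \<and>
     (\<forall>t\<ge>0. (z has_vector_derivative
        ((mat 1 :: real^'N^'N) \<otimes>\<^sub>k G1) *v z t + ((mat 1 :: real^'N^'N) \<otimes>\<^sub>k G2) *v ev (t - tcom P))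
        (at t within {0..}))"

definition augmented_system :: "('N::finite, 'n::finite, 'm::finite, 'p::finite, 'q::finite) plant \<Rightarrow>
    real^'z^'z \<Rightarrow> real^'p^'z \<Rightarrow> ('N, 'n, 'm, 'p, 'q) pert \<Rightarrow> (real \<Rightarrow> real^'q) \<Rightarrow>
    (real \<Rightarrow> real^('N \<times> 'n)) \<Rightarrow> (real \<Rightarrow> real^('N \<times> 'z::finite)) \<Rightarrow>
    (real \<Rightarrow> real^('N \<times> 'm)) \<Rightarrow> (real \<Rightarrow> real^('N \<times> 'p)) \<Rightarrow> bool" where
  "augmented_system P G1 G2 w v x z u ev \<longleftrightarrow>
     auxiliary_system P w v x u ev \<and> internal_model_dynamics P G1 G2 ev z"


section \<open>Control laws\<close>

text \<open>The input is needed from time \<open>-\<tau>\<^sub>c\<^sub>o\<^sub>n\<close> on, since the plant uses \<open>u (t - \<tau>\<^sub>c\<^sub>o\<^sub>n)\<close>.\<close>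

definition state_feedback :: "('N::finite, 'n::finite, 'm::finite, 'p::finite, 'q::finite) plant \<Rightarrow>
    real^('N \<times> 'n)^('N \<times> 'm) \<Rightarrow> real^('N \<times> 'z)^('N \<times> 'm) \<Rightarrow>
    (real \<Rightarrow> real^('N \<times> 'n)) \<Rightarrow> (real \<Rightarrow> real^('N \<times> 'z::finite)) \<Rightarrow> (real \<Rightarrow> real^('N \<times> 'm)) \<Rightarrow> bool" where
  "state_feedback P Kx Kz x z u \<longleftrightarrow> (\<forall>t\<ge>- tcon P. u t = Kx *v x (t - tcom P) + Kz *v z t)"

definition output_feedback :: "('N::finite, 'n::finite, 'm::finite, 'p::finite, 'q::finite) plant \<Rightarrow>
    real^('N \<times> 'z)^('N \<times> 'm) \<Rightarrow> real^('N \<times> 'n)^('N \<times> 'm) \<Rightarrow>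
    real^('N \<times> 'n)^('N \<times> 'n) \<Rightarrow> real^('N \<times> 'p)^('N \<times> 'n) \<Rightarrow>
    real^(('N \<times> 'z) + ('N \<times> 'n))^('N \<times> 'n) \<Rightarrow>
    (real \<Rightarrow> real^('N \<times> 'p)) \<Rightarrow> (real \<Rightarrow> real^('N \<times> 'z::finite)) \<Rightarrow> (real \<Rightarrow> real^('N \<times> 'n)) \<Rightarrow>
    (real \<Rightarrow> real^('N \<times> 'm)) \<Rightarrow> bool" where
  "output_feedback P K1 K2 S1 S2 S3 ev z \<xi> u \<longleftrightarrow>
     (\<forall>t\<ge>- tcon P. u t = K1 *v z t + K2 *v \<xi> t) \<and>
     continuous_on {- tau P..0} \<xi> \<and>
     (\<forall>t\<ge>0. (\<xi> has_vector_derivative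
        S1 *v \<xi> t + S2 *v ev (t - tcom P) + S3 *v col2 (z (t - tau P)) (\<xi> (t - tau P)))
        (at t within {0..}))"

text \<open>The resulting dynamic laws, as relations between the plant state \<open>x\<close>, the error signal \<open>ev\<close>,
  the controller state and the input \<open>u\<close>.\<close>

definition dynamic_state_feedback ::
    "('N::finite, 'n::finite, 'm::finite, 'p::finite, 'q::finite) plant \<Rightarrow>
     real^'z^'z \<Rightarrow> real^'p^'z \<Rightarrow> real^('N \<times> 'n)^('N \<times> 'm) \<Rightarrow> real^('N \<times> 'z)^('N \<times> 'm) \<Rightarrow>
    (real \<Rightarrow> real^('N \<times> 'n)) \<Rightarrow> (real \<Rightarrow> real^('N \<times> 'p)) \<Rightarrow>
    (real \<Rightarrow> real^('N \<times> 'z::finite)) \<Rightarrow> (real \<Rightarrow> real^('N \<times> 'm)) \<Rightarrow> bool" where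
  "dynamic_state_feedback P G1 G2 Kx Kz x ev z u \<longleftrightarrow>
     state_feedback P Kx Kz x z u \<and> internal_model_dynamics P G1 G2 ev z"

definition dynamic_output_feedback ::
    "('N::finite, 'n::finite, 'm::finite, 'p::finite, 'q::finite) plant \<Rightarrow>
     real^'z^'z \<Rightarrow> real^'p^'z \<Rightarrow> real^('N \<times> 'z)^('N \<times> 'm) \<Rightarrow> real^('N \<times> 'n)^('N \<times> 'm) \<Rightarrow>
    real^('N \<times> 'n)^('N \<times> 'n) \<Rightarrow> real^('N \<times> 'p)^('N \<times> 'n) \<Rightarrow>
    real^(('N \<times> 'z) + ('N \<times> 'n))^('N \<times> 'n) \<Rightarrow>
    (real \<Rightarrow> real^('N \<times> 'n)) \<Rightarrow> (real \<Rightarrow> real^('N \<times> 'p)) \<Rightarrow>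
    (real \<Rightarrow> (real^('N \<times> 'z::finite)) \<times> (real^('N \<times> 'n))) \<Rightarrow> (real \<Rightarrow> real^('N \<times> 'm)) \<Rightarrow> bool" where
  "dynamic_output_feedback P G1 G2 K1 K2 S1 S2 S3 x ev \<eta> u \<longleftrightarrow>
     output_feedback P K1 K2 S1 S2 S3 ev (\<lambda>t. fst (\<eta> t)) (\<lambda>t. snd (\<eta> t)) u \<and>
     internal_model_dynamics P G1 G2 ev (\<lambda>t. fst (\<eta> t))"


section \<open>Stability and output regulation\<close>

text \<open>\<open>exp_stable r X\<close>: the linear delay system with maximal delay \<open>r\<close> whose set of
  trajectories is \<open>X\<close> is exponentially stable.\<close>
definition exp_stable :: "real \<Rightarrow> (real \<Rightarrow> 's::real_normed_vector) set \<Rightarrow> bool" where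
  "exp_stable r X \<longleftrightarrow>
     (\<exists>M \<alpha>. M > 0 \<and> \<alpha> > 0 \<and>
        (\<forall>\<phi>\<in>X. \<forall>t\<ge>0. norm (\<phi> t) \<le> M * exp (- \<alpha> * t) * (SUP \<theta>\<in>{- r..0}. norm (\<phi> \<theta>))))"

definition state_feedback_stabilizes ::
    "('N::finite, 'n::finite, 'm::finite, 'p::finite, 'q::finite) plant \<Rightarrow>
     real^'z^'z \<Rightarrow> real^'p^'z \<Rightarrow> real^('N \<times> 'n)^('N \<times> 'm) \<Rightarrow> real^('N \<times> 'z::finite)^('N \<times> 'm) \<Rightarrow> bool" where
  "state_feedback_stabilizes P G1 G2 Kx Kz \<longleftrightarrow>
     exp_stable (tau P) {\<lambda>t. (x t, z t) | x z u ev.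
       augmented_system P G1 G2 0 (\<lambda>_. 0) x z u ev \<and> state_feedback P Kx Kz x z u}"

definition output_feedback_stabilizes ::
    "('N::finite, 'n::finite, 'm::finite, 'p::finite, 'q::finite) plant \<Rightarrow>
     real^'z^'z \<Rightarrow> real^'p^'z \<Rightarrow> real^('N \<times> 'z)^('N \<times> 'm) \<Rightarrow> real^('N \<times> 'n)^('N \<times> 'm) \<Rightarrow>
    real^('N \<times> 'n)^('N \<times> 'n) \<Rightarrow> real^('N \<times> 'p)^('N \<times> 'n) \<Rightarrow>
    real^(('N \<times> 'z::finite) + ('N \<times> 'n))^('N \<times> 'n) \<Rightarrow> bool" where
  "output_feedback_stabilizes P G1 G2 K1 K2 S1 S2 S3 \<longleftrightarrow>
     exp_stable (tau P) {\<lambda>t. (x t, z t, \<xi> t) | x z \<xi> u ev.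
       augmented_system P G1 G2 0 (\<lambda>_. 0) x z u ev \<and> output_feedback P K1 K2 S1 S2 S3 ev z \<xi> u}"

text \<open>Quantifying over all signals \<open>v\<close>, \<open>x\<close>, \<open>\<eta>\<close> that satisfy the closed loop is quantifying over
  all \<open>v\<^sub>0\<close> and all continuous initial functions of \<open>x\<close> and of the controller state \<open>\<eta>\<close>.\<close>
definition solves_robust_output_regulation ::
    "('N::finite, 'n::finite, 'm::finite, 'p::finite, 'q::finite) plant \<Rightarrow>
     ((real \<Rightarrow> real^('N \<times> 'n)) \<Rightarrow> (real \<Rightarrow> real^('N \<times> 'p)) \<Rightarrow>
      (real \<Rightarrow> 's::real_normed_vector) \<Rightarrow> (real \<Rightarrow> real^('N \<times> 'm)) \<Rightarrow> bool) \<Rightarrow> bool" where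
  "solves_robust_output_regulation P law \<longleftrightarrow>
     exp_stable (tau P) {\<lambda>t. (x t, \<eta> t) | x \<eta> u ev.
       auxiliary_system P 0 (\<lambda>_. 0) x u ev \<and> law x ev \<eta> u} \<and>
     (\<exists>W. open W \<and> 0 \<in> W \<and>
       (\<forall>w\<in>W. \<forall>v x \<eta> u ev. auxiliary_system P w v x u ev \<and> law x ev \<eta> u \<longrightarrow>
          (ev \<longlongrightarrow> 0) at_top))"

text \<open>The original plant, agent by agent: states \<open>x i\<close>, inputs \<open>u i\<close>, outputs \<open>y i\<close>, reference
  output \<open>y0\<close> and regulated errors \<open>e i\<close>.\<close>
definition multi_agent_system :: "('N::finite, 'n::finite, 'm::finite, 'p::finite, 'q::finite) plant \<Rightarrow>
    ('N, 'n, 'm, 'p, 'q) pert \<Rightarrow> (real \<Rightarrow> real^'q) \<Rightarrow> ('N \<Rightarrow> real \<Rightarrow> real^'n) \<Rightarrow>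
    ('N \<Rightarrow> real \<Rightarrow> real^'m) \<Rightarrow> ('N \<Rightarrow> real \<Rightarrow> real^'p) \<Rightarrow> (real \<Rightarrow> real^'p) \<Rightarrow>
    ('N \<Rightarrow> real \<Rightarrow> real^'p) \<Rightarrow> bool" where
  "multi_agent_system P w v x u y y0 e \<longleftrightarrow>
     exosystem P v \<and>
     (\<forall>t\<ge>- tau P. y0 t = - (refF P *v v t)) \<and>
     (\<forall>i. continuous_on {- tau P..0} (x i) \<and>
          (\<forall>t\<ge>0. (x i has_vector_derivative
             barA P w i *v x i t + barB P w i *v u i (t - tcon P) + barE P w i *v v t)
             (at t within {0..})) \<and>
          (\<forall>t\<ge>- tau P. y i t = barC P w i *v x i t \<and> e i t = y i t - y0 t))"

definition solves_cooperative_robust_output_regulation ::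
    "('N::finite, 'n::finite, 'm::finite, 'p::finite, 'q::finite) plant \<Rightarrow>
     ((real \<Rightarrow> real^('N \<times> 'n)) \<Rightarrow> (real \<Rightarrow> real^('N \<times> 'p)) \<Rightarrow>
      (real \<Rightarrow> 's::real_normed_vector) \<Rightarrow> (real \<Rightarrow> real^('N \<times> 'm)) \<Rightarrow> bool) \<Rightarrow> bool" where
  "solves_cooperative_robust_output_regulation P law \<longleftrightarrow>
     exp_stable (tau P) {\<lambda>t. (col x t, \<eta> t) | x \<eta> u y y0 e ev.
       multi_agent_system P 0 (\<lambda>_. 0) x u y y0 e \<and>
       error_signal P 0 (\<lambda>_. 0) (col x) ev \<and> law (col x) ev \<eta> (col u)} \<and>
     (\<exists>W. open W \<and> 0 \<in> W \<and>
       (\<forall>w\<in>W. \<forall>v x \<eta> u y y0 e ev.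
          multi_agent_system P w v x u y y0 e \<and>
          error_signal P w v (col x) ev \<and> law (col x) ev \<eta> (col u) \<longrightarrow>
          (\<forall>i. (e i \<longlongrightarrow> 0) at_top)))"

end

theory Submission
  imports Defs
begin

text \<open>
  The proof differentiates the closed loop instead of solving regulator equations.

  Let \<open>f\<close> be the characteristic polynomial of \<open>\<beta>\<close>, of degree \<open>n\<close>, which is also the minimal polynomial
  of \<open>S\<close>. The closed loop is a linear delay equation forced by the exosystem. Its trajectories are \<open>k\<close>
  times differentiable from time \<open>k * \<tau>\<close> on, and \<open>f(d/dt)\<close> commutes with the equation and annihilates
  \<open>v\<close> because \<open>f(S) = 0\<close>. So \<open>f(d/dt)\<close> maps a forced trajectory to an unforced one, which decays as
  soon as the unforced closed loop is stable (\<open>annihilated_forcing\<close>).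

  On the other hand, every component \<open>e\<close> of the delayed error signal drives a copy \<open>\<zeta>' = \<beta> \<zeta> + \<sigma> e\<close> of
  the internal model. Controllability provides a linear functional \<open>c\<close> that vanishes on \<open>\<beta>\<^sup>k \<sigma>\<close> for
  \<open>k < n - 1\<close> and is 1 on \<open>\<beta>\<^sup>n\<^sup>-\<^sup>1 \<sigma>\<close>. With it, \<open>c (f(d/dt) \<zeta>) = c (f(\<beta>) \<zeta>) + e = e\<close>, the last step by
  Cayley and Hamilton. Since \<open>f(d/dt) \<zeta>\<close> decays, so does \<open>e\<close> (\<open>internal_model_error_decays\<close>,
  \<open>internal_model_regulates\<close>).

  It remains to see that unforced trajectories decay not only for \<open>w = 0\<close> but for all small \<open>w\<close>
  (\<open>stability_neighbourhood\<close>). A perturbed trajectory is compared, over a window of fixed length, with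
  the nominal one that has the same history. The nominal one has shrunk by the end of the window, the
  difference is small by a Gronwall estimate, and so the history is halved from window to window
  (\<open>perturbed_contraction\<close>). The comparison needs nominal solutions for arbitrary continuous initial
  functions; they come from a contraction in an exponentially weighted supremum norm
  (\<open>solution_exists\<close>).

  For the original agents, \<open>e\<^sub>v = (H \<otimes> I) e\<close>, and \<open>H\<close> is invertible by a maximum principle along the
  spanning tree (\<open>matH_kernel_trivial\<close>).
\<close>


section \<open>Linear equations with finitely many delays\<close>

text \<open>
  The delays are indexed by a finite type rather than collected in a set because two of them may
  coincide. The forcing \<open>g\<close> is an arbitrary function of time: the exosystem enters through it, and so
  does the perturbation of the coefficients when a perturbed solution is compared with a nominal one.
\<close>
definition delay_solution ::
    "real \<Rightarrow> ('k::finite \<Rightarrow> real) \<Rightarrow> ('k \<Rightarrow> 'e \<Rightarrow> 'e::real_normed_vector) \<Rightarrow> (real \<Rightarrow> 'e) \<Rightarrow> real \<Rightarrow>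
     (real \<Rightarrow> 'e) \<Rightarrow> bool" where
  "delay_solution r d A g a \<phi> \<longleftrightarrow>
     continuous_on {a - r..} \<phi> \<and>
     (\<forall>t\<ge>a. (\<phi> has_vector_derivative (\<Sum>k\<in>UNIV. A k (\<phi> (t - d k))) + g t) (at t within {a..}))"

lemma at_within_atLeast_eq:
  fixes t a :: real
  assumes "a < t" shows "at t within {a..} = at t"
  using assms by (intro at_within_interior) (simp add: interior_real_atLeast)

lemma at_within_atLeast_neq_bot: "a \<le> t \<Longrightarrow> at t within {a..} \<noteq> bot" for a t :: real
proof -
  assume "a \<le> t"
  then have "at_right t \<le> at t within {a..}" by (intro at_le) auto
  then show ?thesis using trivial_limit_at_right_real[of t] bot.extremum_uniqueI by metis
qed

text \<open>
  Mean value inequality with an exponential majorant. It takes the place of every integral estimate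
  below, where the right-hand side of a delay equation is bounded by a multiple of \<open>exp (\<kappa> * (t - a))\<close>.
\<close>
lemma exponential_growth_bound:
  fixes f :: "real \<Rightarrow> 'e::real_normed_vector"
  assumes "a \<le> b" "\<kappa> > 0"
    and df: "\<And>t. a \<le> t \<Longrightarrow> (f has_vector_derivative f' t) (at t within {a..})"
    and bd: "\<And>t. a < t \<Longrightarrow> t < b \<Longrightarrow> norm (f' t) \<le> c * exp (\<kappa> * (t - a))"
  shows "norm (f b - f a) \<le> c / \<kappa> * (exp (\<kappa> * (b - a)) - 1)"
proof (cases "a = b")
  case False
  have "continuous_on {a..} f"
    using df by (auto simp: continuous_on_eq_continuous_within intro: has_vector_derivative_continuous)
  then have c: "continuous_on {a..b} f" by (rule continuous_on_subset) auto
  have "norm (f b - f a) \<le> c / \<kappa> * exp (\<kappa> * (b - a)) - c / \<kappa> * exp (\<kappa> * (a - a))"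
  proof (rule differentiable_bound_general[where f'=f' and \<phi>="\<lambda>t. c / \<kappa> * exp (\<kappa> * (t - a))" and \<phi>'="\<lambda>t. c * exp (\<kappa> * (t - a))"])
    show "a < b" using False assms(1) by simp
    show "(f has_vector_derivative f' x) (at x)" if "a < x" "x < b" for x
      using df[of x] that by (simp add: at_within_atLeast_eq)
    show "((\<lambda>t. c / \<kappa> * exp (\<kappa> * (t - a))) has_vector_derivative c * exp (\<kappa> * (x - a))) (at x)" for x
      unfolding has_real_derivative_iff_has_vector_derivative[symmetric]
      by (rule derivative_eq_intros refl | use \<open>\<kappa> > 0\<close> in simp)+
  qed (use \<open>\<kappa> > 0\<close> in \<open>auto intro!: continuous_intros c bd\<close>)
  then show ?thesis by (simp add: algebra_simps)
qed simp

lemma has_vector_derivative_shift_atLeast: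
  fixes f :: "real \<Rightarrow> 'e::real_normed_vector"
  assumes "(f has_vector_derivative D) (at (t - s) within {a..})"
  shows "((\<lambda>t. f (t - s)) has_vector_derivative D) (at t within {a + s..})"
proof -
  have img: "(\<lambda>t. t - s) ` {a + s..} = {a..}"
  proof -
    have "x \<in> (\<lambda>t. t - s) ` {a + s..}" if "a \<le> x" for x
      using that by (intro image_eqI[of _ _ "x + s"]) auto
    then show ?thesis by auto
  qed
  have "((\<lambda>t. t - s) has_vector_derivative 1) (at t within {a + s..})"
    by (auto intro!: derivative_eq_intros)
  from vector_diff_chain_within[OF this, of f D] show ?thesis
    using assms unfolding img by (simp add: o_def)
qed

lemma indefinite_integral_from_0:
  fixes h :: "real \<Rightarrow> 'e::banach"
  assumes h: "continuous_on UNIV h"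
  shows indefinite_integral_deriv:
      "0 \<le> t \<Longrightarrow> ((\<lambda>t. integral {0..t} h) has_vector_derivative h t) (at t within {0..})"
    and indefinite_integral_cont: "continuous_on UNIV (\<lambda>t. integral {0..t} h)"
    and indefinite_integral_neg: "t \<le> 0 \<Longrightarrow> integral {0..t} h = 0"
proof -
  have d: "((\<lambda>t. integral {0..t} h) has_vector_derivative h t) (at t within {0..})" if "0 \<le> t" for t
  proof -
    have "continuous_on {0..t+1} h" using h continuous_on_subset by blast
    from integral_has_vector_derivative[OF this, of t]
    have "((\<lambda>t. integral {0..t} h) has_vector_derivative h t) (at t within {0..t+1})"
      using that by simp
    moreover have "at t within {0..t+1} = at t within {0..}"
      by (rule at_within_nhd[of _ "{..<t+1}"]) (use that in auto)
    ultimately show ?thesis by simp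
  qed
  then show "0 \<le> t \<Longrightarrow> ((\<lambda>t. integral {0..t} h) has_vector_derivative h t) (at t within {0..})" .
  show neg: "integral {0..t} h = 0" if "t \<le> 0" for t
    using that by (cases "t = 0") auto
  have "continuous_on {0..} (\<lambda>t. integral {0..t} h)"
    using d by (auto simp: continuous_on_eq_continuous_within intro: has_vector_derivative_continuous)
  moreover have "continuous_on {..0} (\<lambda>t. integral {0..t} h)"
    by (subst continuous_on_cong[OF refl, where g="\<lambda>_. 0"]) (auto simp: neg)
  ultimately have "continuous_on ({0..} \<union> {..0}) (\<lambda>t. integral {0..t} h)"
    by (intro continuous_on_closed_Un) auto
  moreover have "{0::real..} \<union> {..0} = UNIV" by auto
  ultimately show "continuous_on UNIV (\<lambda>t. integral {0..t} h)" by simp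
qed

lemma delay_solution_mono:
  assumes "delay_solution r d A g a \<phi>" "a \<le> b"
  shows "delay_solution r d A g b \<phi>"
  unfolding delay_solution_def
proof safe
  show "continuous_on {b - r..} \<phi>"
    using assms by (auto simp: delay_solution_def elim!: continuous_on_subset)
  show "(\<phi> has_vector_derivative (\<Sum>k\<in>UNIV. A k (\<phi> (t - d k))) + g t) (at t within {b..})"
    if "b \<le> t" for t
    using assms that
    by (intro has_vector_derivative_within_subset[of _ _ _ "{a..}" "{b..}"]) (auto simp: delay_solution_def)
qed

lemma delay_solution_shift:
  assumes "delay_solution r d A g a \<phi>"
  shows "delay_solution r d A (\<lambda>t. g (t - s)) (a + s) (\<lambda>t. \<phi> (t - s))"
  unfolding delay_solution_def
proof safe
  have "continuous_on {a - r..} \<phi>" using assms by (simp add: delay_solution_def)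
  then show "continuous_on {a + s - r..} (\<lambda>t. \<phi> (t - s))"
    by (rule continuous_on_compose2) (auto intro!: continuous_intros)
  fix t assume "a + s \<le> t"
  then have "(\<phi> has_vector_derivative (\<Sum>k\<in>UNIV. A k (\<phi> (t - s - d k))) + g (t - s)) (at (t - s) within {a..})"
    using assms by (simp add: delay_solution_def)
  from has_vector_derivative_shift_atLeast[OF this]
  show "((\<lambda>t. \<phi> (t - s)) has_vector_derivative (\<Sum>k\<in>UNIV. A k (\<phi> (t - d k - s))) + g (t - s)) (at t within {a + s..})"
    by (simp add: algebra_simps)
qed

locale delay_equation =
  fixes r :: real and d :: "'k::finite \<Rightarrow> real" and A :: "'k \<Rightarrow> 'e \<Rightarrow> 'e::euclidean_space"
  assumes delay: "\<And>k. 0 \<le> d k" "\<And>k. d k \<le> r"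
    and linear_A: "\<And>k. bounded_linear (A k)"
begin

definition gain :: real where "gain = (\<Sum>k\<in>UNIV. onorm (A k))"

lemma gain_nonneg: "0 \<le> gain"
  unfolding gain_def by (intro sum_nonneg onorm_pos_le linear_A)

lemma r_nonneg: "0 \<le> r" using delay order_trans by blast

lemma norm_delayed_sum_le:
  assumes "\<And>k. norm (y k) \<le> B"
  shows "norm (\<Sum>k\<in>UNIV. A k (y k)) \<le> gain * B"
proof -
  have "norm (A k (y k)) \<le> onorm (A k) * B" for k
    using onorm[OF linear_A, of k "y k"] assms[of k] onorm_pos_le[OF linear_A, of k]
    by (meson mult_left_mono order_trans)
  then show ?thesis unfolding gain_def sum_distrib_right by (intro sum_norm_le) auto
qed

lemma delay_solution_sum:
  assumes "\<And>i. i \<in> I \<Longrightarrow> delay_solution r d A (g i) a (\<phi> i)"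
  shows "delay_solution r d A (\<lambda>t. \<Sum>i\<in>I. c i *\<^sub>R g i t) a (\<lambda>t. \<Sum>i\<in>I. c i *\<^sub>R \<phi> i t)"
  unfolding delay_solution_def
proof safe
  show "continuous_on {a - r..} (\<lambda>t. \<Sum>i\<in>I. c i *\<^sub>R \<phi> i t)"
    using assms by (auto simp: delay_solution_def intro!: continuous_intros)
  fix t assume "a \<le> t"
  then have "((\<lambda>t. \<Sum>i\<in>I. c i *\<^sub>R \<phi> i t) has_vector_derivative
      (\<Sum>i\<in>I. c i *\<^sub>R ((\<Sum>k\<in>UNIV. A k (\<phi> i (t - d k))) + g i t))) (at t within {a..})"
    using assms by (auto simp: delay_solution_def intro!: derivative_eq_intros)
  moreover have "(\<Sum>i\<in>I. c i *\<^sub>R ((\<Sum>k\<in>UNIV. A k (\<phi> i (t - d k))) + g i t)) =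
      (\<Sum>k\<in>UNIV. A k (\<Sum>i\<in>I. c i *\<^sub>R \<phi> i (t - d k))) + (\<Sum>i\<in>I. c i *\<^sub>R g i t)"
    by (simp add: linear_sum[OF bounded_linear.linear[OF linear_A]]
        linear_cmul[OF bounded_linear.linear[OF linear_A]] scaleR_add_right sum.distrib scaleR_sum_right
        sum.swap[of _ I])
  ultimately show "((\<lambda>t. \<Sum>i\<in>I. c i *\<^sub>R \<phi> i t) has_vector_derivative
      (\<Sum>k\<in>UNIV. A k (\<Sum>i\<in>I. c i *\<^sub>R \<phi> i (t - d k))) + (\<Sum>i\<in>I. c i *\<^sub>R g i t)) (at t within {a..})"
    by simp
qed

lemma delay_solution_diff:
  assumes "delay_solution r d A g a \<phi>" "delay_solution r d A h a \<psi>"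
  shows "delay_solution r d A (\<lambda>t. g t - h t) a (\<lambda>t. \<phi> t - \<psi> t)"
  using delay_solution_sum[of UNIV "\<lambda>b::bool. if b then g else h" a "\<lambda>b. if b then \<phi> else \<psi>"
      "\<lambda>b. if b then 1 else -1"] assms
  by (simp add: UNIV_bool)

text \<open>
  Gronwall estimate. The weight \<open>exp (- \<kappa> * (t - a))\<close> with \<open>\<kappa> = 2 * gain + 1\<close> makes the delayed terms
  contribute at most half of the weighted maximum \<open>m\<close> to itself, so that \<open>m \<le> (B + G) + m / 2\<close>. Delays
  do no harm because the weight is nonincreasing.
\<close>
lemma solution_bound:
  assumes sol: "delay_solution r d A g a \<phi>"
    and init: "\<And>\<theta>. a - r \<le> \<theta> \<Longrightarrow> \<theta> \<le> a \<Longrightarrow> norm (\<phi> \<theta>) \<le> B"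
    and forcing: "\<And>t. a \<le> t \<Longrightarrow> t \<le> b \<Longrightarrow> norm (g t) \<le> G"
    and b: "a \<le> b"
  shows "norm (\<phi> b) \<le> 2 * (B + G) * exp ((2 * gain + 1) * (b - a))"
proof -
  define \<kappa> where "\<kappa> = 2 * gain + 1"
  have \<kappa>: "\<kappa> \<ge> 1" "gain / \<kappa> \<le> 1/2" using gain_nonneg by (auto simp: \<kappa>_def field_simps)
  define q where "q t = norm (\<phi> t) * exp (- \<kappa> * max (t - a) 0)" for t
  have cont: "continuous_on {a - r..} \<phi>" using sol by (simp add: delay_solution_def)
  have "continuous_on {a - r..b} q" unfolding q_def
    by (intro continuous_intros continuous_on_subset[OF cont]) auto
  then obtain s where s: "s \<in> {a - r..b}" "\<And>t. t \<in> {a - r..b} \<Longrightarrow> q t \<le> q s"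
    using continuous_attains_sup[of "{a - r..b}" q] r_nonneg b by fastforce
  have B: "0 \<le> B" using init[of a] r_nonneg norm_ge_zero[of "\<phi> a"] by linarith
  have G: "0 \<le> G" using forcing[of a] b norm_ge_zero[of "g a"] by linarith
  define m where "m = q s"
  have m0: "0 \<le> m" by (simp add: m_def q_def)
  have le: "norm (\<phi> t) \<le> m * exp (\<kappa> * max (t - a) 0)" if "t \<in> {a - r..b}" for t
    using s(2)[OF that] by (simp add: m_def q_def exp_minus field_simps)
  have "m \<le> 2 * (B + G)"
  proof (cases "s \<le> a")
    case True
    then have "m \<le> B" using init[of s] s(1) by (simp add: m_def q_def)
    then show ?thesis using B G by auto
  next
    case False
    have "norm (\<phi> s - \<phi> a) \<le> (gain * m + G) / \<kappa> * (exp (\<kappa> * (s - a)) - 1)"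
    proof (rule exponential_growth_bound)
      show "a \<le> s" "0 < \<kappa>" using False \<kappa> by auto
      fix t assume "a \<le> t"
      then show "(\<phi> has_vector_derivative (\<Sum>k\<in>UNIV. A k (\<phi> (t - d k))) + g t) (at t within {a..})"
        using sol by (simp add: delay_solution_def)
    next
      fix t assume t: "a < t" "t < s"
      have "norm (\<phi> (t - d k)) \<le> m * exp (\<kappa> * (t - a))" for k
      proof -
        have "norm (\<phi> (t - d k)) \<le> m * exp (\<kappa> * max (t - d k - a) 0)"
          by (rule le) (use t delay[of k] s(1) in auto)
        also have "\<dots> \<le> m * exp (\<kappa> * (t - a))"
          using t delay[of k] m0 \<kappa> by (intro mult_left_mono) auto
        finally show ?thesis .
      qed
      then have "norm (\<Sum>k\<in>UNIV. A k (\<phi> (t - d k))) \<le> gain * (m * exp (\<kappa> * (t - a)))"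
        by (rule norm_delayed_sum_le)
      moreover have "norm (g t) \<le> G * exp (\<kappa> * (t - a))"
      proof -
        have "norm (g t) \<le> G * 1" using forcing[of t] t s(1) by auto
        also have "\<dots> \<le> G * exp (\<kappa> * (t - a))" using G t \<kappa> by (intro mult_left_mono) auto
        finally show ?thesis .
      qed
      ultimately show "norm ((\<Sum>k\<in>UNIV. A k (\<phi> (t - d k))) + g t) \<le> (gain * m + G) * exp (\<kappa> * (t - a))"
        by (intro order_trans[OF norm_triangle_ineq]) (simp add: algebra_simps)
    qed
    also have "\<dots> \<le> (m / 2 + G) * (exp (\<kappa> * (s - a)) - 1)"
    proof (rule mult_right_mono)
      have "m * gain \<le> m * (\<kappa> / 2)" using m0 \<kappa> by (intro mult_left_mono) (auto simp: \<kappa>_def)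
      moreover have "G * 1 \<le> G * \<kappa>" using G \<kappa> by (intro mult_left_mono) auto
      ultimately show "(gain * m + G) / \<kappa> \<le> m / 2 + G" using \<kappa> by (simp add: field_simps)
    qed (use False \<kappa> in auto)
    finally have "norm (\<phi> s) \<le> B + (m / 2 + G) * (exp (\<kappa> * (s - a)) - 1)"
      using init[of a] r_nonneg norm_triangle_ineq2[of "\<phi> s" "\<phi> a"] by linarith
    also have "\<dots> \<le> (B + m / 2 + G) * exp (\<kappa> * (s - a))"
    proof -
      have "B * 1 \<le> B * exp (\<kappa> * (s - a))" using B False \<kappa> by (intro mult_left_mono) auto
      then show ?thesis using m0 G by (simp add: algebra_simps)
    qed
    finally have "norm (\<phi> s) \<le> (B + m / 2 + G) * exp (\<kappa> * (s - a))" .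
    moreover have "norm (\<phi> s) = m * exp (\<kappa> * (s - a))"
      using False by (simp add: m_def q_def flip: exp_add)
    ultimately have "m * exp (\<kappa> * (s - a)) \<le> (B + m / 2 + G) * exp (\<kappa> * (s - a))" by simp
    then have "m \<le> B + m / 2 + G" by simp
    then show ?thesis by simp
  qed
  then have "m * exp (\<kappa> * max (b - a) 0) \<le> 2 * (B + G) * exp (\<kappa> * (b - a))"
    using b by (intro mult_mono) (auto simp: B G)
  moreover have "b \<in> {a - r..b}" using b r_nonneg by simp
  ultimately show ?thesis using le[of b] unfolding \<kappa>_def by linarith
qed

text \<open>
  Picard's fixed point for zero initial data. In the variable \<open>\<omega> t = exp (- \<kappa> * t) *\<^sub>R \<phi> t\<close> the integral
  operator maps bounded continuous functions on the whole line to such functions and contracts with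
  factor \<open>gain / \<kappa> \<le> 1/2\<close>, which gives a global solution in one step.
\<close>
lemma forced_solution_exists:
  assumes g: "continuous_on UNIV g" "\<And>t. norm (g t) \<le> G"
  obtains \<phi> where "delay_solution r d A g 0 \<phi>" "continuous_on UNIV \<phi>" "\<And>t. t \<le> 0 \<Longrightarrow> \<phi> t = 0"
proof -
  define \<kappa> where "\<kappa> = 2 * gain + 1"
  have \<kappa>: "\<kappa> > 0" "gain / \<kappa> \<le> 1/2" using gain_nonneg by (auto simp: \<kappa>_def field_simps)
  define h where "h \<omega> s = (\<Sum>k\<in>UNIV. A k (exp (\<kappa> * (s - d k)) *\<^sub>R apply_bcontfun \<omega> (s - d k))) + g s" for \<omega> s
  define J where "J \<omega> t = integral {0..t} (h \<omega>)" for \<omega> t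
  define F where "F \<omega> t = exp (- \<kappa> * max t 0) *\<^sub>R J \<omega> t" for \<omega> t
  have G: "0 \<le> G" using g(2)[of 0] norm_ge_zero[of "g 0"] by linarith
  have lb: "continuous_on UNIV (\<lambda>x. A k (y x))" if "continuous_on UNIV y" for k and y :: "real \<Rightarrow> 'e"
    using bounded_linear.continuous_on[OF linear_A that] .
  have hc: "continuous_on UNIV (h \<omega>)" for \<omega>
    unfolding h_def
    by (intro continuous_intros lb g(1) continuous_on_compose2[OF continuous_on_apply_bcontfun[of UNIV]]) auto
  note J = indefinite_integral_from_0[OF hc, folded J_def]
  have J0: "J \<omega> 0 = 0" for \<omega> by (simp add: J(3))
  \<comment> \<open>The factor \<open>exp (\<kappa> * s)\<close> increases with \<open>s\<close>, so at a delayed time it is at most its present value.\<close>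
  have wb: "norm (\<Sum>k\<in>UNIV. A k (exp (\<kappa> * (s - d k)) *\<^sub>R y (s - d k))) \<le> gain * b * exp (\<kappa> * s)"
    if "\<And>t. norm (y t) \<le> b" for y :: "real \<Rightarrow> 'e" and b s
  proof -
    have "norm (exp (\<kappa> * (s - d k)) *\<^sub>R y (s - d k)) \<le> exp (\<kappa> * s) * b" for k
    proof -
      have "exp (\<kappa> * (s - d k)) \<le> exp (\<kappa> * s)" using delay[of k] \<kappa> by simp
      then show ?thesis using that[of "s - d k"] by (simp add: mult_mono)
    qed
    from norm_delayed_sum_le[OF this] show ?thesis by (simp add: mult_ac)
  qed
  have unweight: "norm (exp (- (\<kappa> * t)) *\<^sub>R y) \<le> c" if "norm y \<le> c * exp (\<kappa> * t)" for y :: 'e and c t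
    using mult_left_mono[OF that, of "exp (- (\<kappa> * t))"] by (simp add: mult.left_commute flip: exp_add)
  have Fb: "norm (F \<omega> t) \<le> (gain * norm \<omega> + G) / \<kappa>" for \<omega> t
  proof (cases "t \<le> 0")
    case True
    then show ?thesis using G gain_nonneg \<kappa> by (simp add: F_def J(3))
  next
    case False
    have "norm (J \<omega> t - J \<omega> 0) \<le> (gain * norm \<omega> + G) / \<kappa> * (exp (\<kappa> * (t - 0)) - 1)"
    proof (rule exponential_growth_bound)
      show "0 \<le> t" "0 < \<kappa>" using False \<kappa> by auto
      fix s :: real assume s: "0 < s"
      have "norm (\<Sum>k\<in>UNIV. A k (exp (\<kappa> * (s - d k)) *\<^sub>R apply_bcontfun \<omega> (s - d k))) \<le> gain * norm \<omega> * exp (\<kappa> * s)"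
        by (rule wb) (rule norm_bounded)
      moreover have "norm (g s) \<le> G * exp (\<kappa> * s)"
        using mult_left_mono[of 1 "exp (\<kappa> * s)" G] g(2)[of s] G s \<kappa> by simp
      ultimately show "norm (h \<omega> s) \<le> (gain * norm \<omega> + G) * exp (\<kappa> * (s - 0))"
        unfolding h_def by (intro order_trans[OF norm_triangle_ineq]) (simp add: algebra_simps)
    qed (rule J(1))
    also have "\<dots> \<le> (gain * norm \<omega> + G) / \<kappa> * exp (\<kappa> * t)"
      using \<kappa> G gain_nonneg by (intro mult_left_mono) auto
    finally show ?thesis using False unweight[of "J \<omega> t"] by (simp add: J0 F_def)
  qed
  have Fc: "continuous_on UNIV (F \<omega>)" for \<omega>
    unfolding F_def by (intro continuous_intros J(2))
  have "F \<omega> \<in> bcontfun" for \<omega> using Fc Fb by (rule bcontfun_normI)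
  then have ap: "apply_bcontfun (Bcontfun (F \<omega>)) = F \<omega>" for \<omega> by (simp add: Bcontfun_inverse)
  have "norm (Bcontfun (F \<omega>) - Bcontfun (F \<eta>)) \<le> 1/2 * norm (\<omega> - \<eta>)" for \<omega> \<eta>
  proof (rule norm_bound)
    fix t
    have "norm (F \<omega> t - F \<eta> t) \<le> 1/2 * norm (\<omega> - \<eta>)"
    proof (cases "t \<le> 0")
      case True
      then show ?thesis by (simp add: F_def J(3))
    next
      case False
      define N where "N = norm (\<omega> - \<eta>)"
      have "norm ((J \<omega> t - J \<eta> t) - (J \<omega> 0 - J \<eta> 0)) \<le> (gain * N) / \<kappa> * (exp (\<kappa> * (t - 0)) - 1)"
      proof (rule exponential_growth_bound)
        show "0 \<le> t" "0 < \<kappa>" using False \<kappa> by auto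
        show "((\<lambda>t. J \<omega> t - J \<eta> t) has_vector_derivative h \<omega> s - h \<eta> s) (at s within {0..})" if "0 \<le> s" for s
          by (intro derivative_intros J that)
        fix s :: real assume s: "0 < s"
        have "norm (\<Sum>k\<in>UNIV. A k (exp (\<kappa> * (s - d k)) *\<^sub>R apply_bcontfun (\<omega> - \<eta>) (s - d k))) \<le> gain * N * exp (\<kappa> * s)"
          unfolding N_def by (rule wb) (rule norm_bounded)
        moreover have "(\<Sum>k\<in>UNIV. A k (exp (\<kappa> * (s - d k)) *\<^sub>R apply_bcontfun (\<omega> - \<eta>) (s - d k))) = h \<omega> s - h \<eta> s"
          by (simp add: h_def sum_subtractf[symmetric] scaleR_diff_right
              linear_diff[OF bounded_linear.linear[OF linear_A]])
        ultimately show "norm (h \<omega> s - h \<eta> s) \<le> gain * N * exp (\<kappa> * (s - 0))" by simp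
      qed
      also have "\<dots> \<le> gain * N / \<kappa> * exp (\<kappa> * t)"
        using \<kappa> gain_nonneg by (intro mult_left_mono) (auto simp: N_def)
      finally have "norm (F \<omega> t - F \<eta> t) \<le> gain / \<kappa> * N"
        using False unweight[of "J \<omega> t - J \<eta> t"] by (simp add: J0 F_def scaleR_diff_right)
      also have "\<dots> \<le> 1/2 * N" using \<kappa> by (intro mult_right_mono) (auto simp: N_def)
      finally show ?thesis by (simp add: N_def)
    qed
    then show "norm (apply_bcontfun (Bcontfun (F \<omega>) - Bcontfun (F \<eta>)) t) \<le> 1/2 * norm (\<omega> - \<eta>)"
      by (simp add: ap)
  qed
  then have "\<exists>!\<omega>. Bcontfun (F \<omega>) = \<omega>"
    by (intro banach_fix_type[of "1/2"]) (auto simp: dist_norm)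
  then obtain \<omega> where "Bcontfun (F \<omega>) = \<omega>" by blast
  then have fp: "apply_bcontfun \<omega> = F \<omega>" using ap by metis
  define \<phi> where "\<phi> t = exp (\<kappa> * t) *\<^sub>R apply_bcontfun \<omega> t" for t
  have pos: "\<phi> t = J \<omega> t" if "0 \<le> t" for t
    using that by (simp add: \<phi>_def fp F_def exp_minus)
  show thesis
  proof
    show c: "continuous_on UNIV \<phi>" unfolding \<phi>_def by (intro continuous_intros) auto
    show "\<phi> t = 0" if "t \<le> 0" for t using that by (simp add: \<phi>_def fp F_def J(3))
    have hp: "h \<omega> t = (\<Sum>k\<in>UNIV. A k (\<phi> (t - d k))) + g t" for t by (simp add: h_def \<phi>_def)
    show "delay_solution r d A g 0 \<phi>" unfolding delay_solution_def
    proof safe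
      show "continuous_on {0 - r..} \<phi>" using c continuous_on_subset by blast
      fix t :: real assume t: "0 \<le> t"
      have "(\<phi> has_vector_derivative h \<omega> t) (at t within {0..})"
        by (rule has_vector_derivative_transform[OF _ _ J(1)]) (use t pos in auto)
      then show "(\<phi> has_vector_derivative (\<Sum>k\<in>UNIV. A k (\<phi> (t - d k))) + g t) (at t within {0..})"
        by (simp add: hp)
    qed
  qed
qed

text \<open>
  Reduction to zero initial data: extend the initial function constantly to the line and let the
  forcing account for its delayed values.
\<close>
lemma solution_exists:
  assumes "continuous_on {- r..0} \<phi>\<^sub>0"
  obtains \<phi> where "delay_solution r d A (\<lambda>_. 0) 0 \<phi>" "\<And>\<theta>. - r \<le> \<theta> \<Longrightarrow> \<theta> \<le> 0 \<Longrightarrow> \<phi> \<theta> = \<phi>\<^sub>0 \<theta>"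
proof -
  define p where "p t = \<phi>\<^sub>0 (max (- r) (min t 0))" for t
  have pc: "continuous_on UNIV p" unfolding p_def
    by (rule continuous_on_compose2[OF assms]) (use r_nonneg in \<open>auto intro!: continuous_intros\<close>)
  obtain b where b: "\<And>t. norm (p t) \<le> b"
  proof -
    have "compact (\<phi>\<^sub>0 ` {- r..0})" using assms by (intro compact_continuous_image) auto
    then obtain b where "\<And>x. x \<in> \<phi>\<^sub>0 ` {- r..0} \<Longrightarrow> norm x \<le> b"
      using compact_imp_bounded bounded_iff by metis
    then have "norm (p t) \<le> b" for t using r_nonneg unfolding p_def by auto
    then show thesis by (rule that)
  qed
  have lb: "continuous_on UNIV (\<lambda>x. A k (y x))" if "continuous_on UNIV y" for k and y :: "real \<Rightarrow> 'e"
    using bounded_linear.continuous_on[OF linear_A that] .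
  obtain \<psi> where \<psi>: "delay_solution r d A (\<lambda>t. \<Sum>k\<in>UNIV. A k (p (t - d k))) 0 \<psi>" "continuous_on UNIV \<psi>"
      "\<And>t. t \<le> 0 \<Longrightarrow> \<psi> t = 0"
    by (rule forced_solution_exists[of "\<lambda>t. \<Sum>k\<in>UNIV. A k (p (t - d k))" "gain * b"])
       (auto intro!: continuous_intros lb continuous_on_compose2[OF pc] norm_delayed_sum_le b)
  define \<phi> where "\<phi> t = p t + \<psi> t" for t
  have p0: "p t = p 0" if "0 \<le> t" for t using that by (simp add: p_def)
  show thesis
  proof
    show "\<phi> \<theta> = \<phi>\<^sub>0 \<theta>" if "- r \<le> \<theta>" "\<theta> \<le> 0" for \<theta> using that by (simp add: \<phi>_def p_def \<psi>(3))
    show "delay_solution r d A (\<lambda>_. 0) 0 \<phi>" unfolding delay_solution_def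
    proof safe
      have "continuous_on UNIV \<phi>" unfolding \<phi>_def by (intro continuous_intros pc \<psi>)
      then show "continuous_on {0 - r..} \<phi>" using continuous_on_subset by blast
      fix t :: real assume t: "0 \<le> t"
      have "((\<lambda>t. p 0 + \<psi> t) has_vector_derivative
          0 + ((\<Sum>k\<in>UNIV. A k (\<psi> (t - d k))) + (\<Sum>k\<in>UNIV. A k (p (t - d k))))) (at t within {0..})"
        by (rule has_vector_derivative_add[OF has_vector_derivative_const])
           (use \<psi>(1) t in \<open>simp add: delay_solution_def\<close>)
      then have "(\<phi> has_vector_derivative
          0 + ((\<Sum>k\<in>UNIV. A k (\<psi> (t - d k))) + (\<Sum>k\<in>UNIV. A k (p (t - d k))))) (at t within {0..})"
        by (rule has_vector_derivative_transform[rotated 2]) (use t in \<open>auto simp: \<phi>_def dest: p0\<close>)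
      then show "(\<phi> has_vector_derivative (\<Sum>k\<in>UNIV. A k (\<phi> (t - d k))) + 0) (at t within {0..})"
        by (simp add: \<phi>_def linear_add[OF bounded_linear.linear[OF linear_A]] sum.distrib add.commute)
    qed
  qed
qed

section \<open>Robustness of exponential stability\<close>

text \<open>
  Over one window of length \<open>L = T + r\<close> a solution of a slightly perturbed equation is compared with the
  nominal solution that starts from the same initial function. After time \<open>T\<close> the nominal solution is at
  most a quarter of the initial bound \<open>B\<close>; the difference solves the nominal equation with zero initial
  data and a forcing of size \<open>O(\<epsilon> * B)\<close>, so the Gronwall estimate makes it at most \<open>B / 4\<close> as well. The
  extra length \<open>r\<close> is there so that a whole history interval is halved, which is what iterating needs.
  The coarse bound \<open>E * B\<close> covers the times within a window.
\<close>
lemma perturbed_contraction: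
  assumes M: "0 < M" "0 < \<alpha>"
    and stable: "\<And>\<phi> t. delay_solution r d A (\<lambda>_. 0) 0 \<phi> \<Longrightarrow> 0 \<le> t \<Longrightarrow>
      norm (\<phi> t) \<le> M * exp (- \<alpha> * t) * (SUP \<theta>\<in>{- r..0}. norm (\<phi> \<theta>))"
  obtains \<epsilon> L E where "0 < \<epsilon>" "0 < L" "0 < E"
    and "\<And>A' \<phi> a B t. (\<And>k. bounded_linear (A' k)) \<Longrightarrow> (\<And>k y. norm (A' k y - A k y) \<le> \<epsilon> * norm y) \<Longrightarrow>
      delay_solution r d A' (\<lambda>_. 0) a \<phi> \<Longrightarrow> (\<And>\<theta>. a - r \<le> \<theta> \<Longrightarrow> \<theta> \<le> a \<Longrightarrow> norm (\<phi> \<theta>) \<le> B) \<Longrightarrow>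
      (a \<le> t \<and> t \<le> a + L \<longrightarrow> norm (\<phi> t) \<le> E * B) \<and> (a + L - r \<le> t \<and> t \<le> a + L \<longrightarrow> norm (\<phi> t) \<le> B / 2)"
proof -
  define c where "c = real CARD('k)"
  have c: "0 < c" by (simp add: c_def)
  define T where "T = max 1 (ln (4 * M) / \<alpha>)"
  have T: "0 < T" "M * exp (- \<alpha> * t) \<le> 1/4" if "T \<le> t" for t
  proof -
    show "0 < T" by (simp add: T_def)
    have "ln (4 * M) / \<alpha> \<le> t" using that by (simp add: T_def)
    then have "ln (4 * M) \<le> \<alpha> * t" using M by (simp add: field_simps)
    then have "4 * M \<le> exp (\<alpha> * t)" using M by (metis exp_le_cancel_iff exp_ln mult_pos_pos zero_less_numeral)
    then show "M * exp (- \<alpha> * t) \<le> 1/4" by (simp add: exp_minus field_simps)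
  qed
  define L where "L = T + r"
  have L: "0 < L" "T \<le> L" using T(1)[of T] r_nonneg by (auto simp: L_def)
  \<comment> \<open>\<open>E\<close> dominates the Gronwall factors over one window of the nominal equation and of every
    perturbed equation with \<open>\<epsilon> \<le> 1\<close>.\<close>
  define E where "E = exp ((2 * (gain + c) + 1) * L)"
  \<comment> \<open>With this choice the Gronwall bound \<open>2 * (c * (\<epsilon> * (2 * B * E))) * E\<close> for the difference is at most \<open>B / 4\<close>.\<close>
  define \<epsilon> where "\<epsilon> = min 1 (1 / (16 * c * (E * E)))"
  have E: "0 < E" by (simp add: E_def)
  have eps: "0 < \<epsilon>" "\<epsilon> \<le> 1" "16 * c * (E * E) * \<epsilon> \<le> 1"
  proof -
    have p: "0 < 16 * c * (E * E)" using c E by simp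
    then show "0 < \<epsilon>" "\<epsilon> \<le> 1" by (auto simp: \<epsilon>_def)
    have "16 * c * (E * E) * \<epsilon> \<le> 16 * c * (E * E) * (1 / (16 * c * (E * E)))"
      using p by (intro mult_left_mono) (auto simp: \<epsilon>_def)
    then show "16 * c * (E * E) * \<epsilon> \<le> 1" using p c E by (simp split: if_splits)
  qed
  show thesis
  proof (rule that)
    show "0 < \<epsilon>" "0 < L" "0 < 2 * E" using eps L E by auto
    fix A' \<phi> a B t
    assume lin: "\<And>k. bounded_linear (A' k)" and close: "\<And>k y. norm (A' k y - A k y) \<le> \<epsilon> * norm y"
      and sol: "delay_solution r d A' (\<lambda>_. 0) a \<phi>"
      and init: "\<And>\<theta>. a - r \<le> \<theta> \<Longrightarrow> \<theta> \<le> a \<Longrightarrow> norm (\<phi> \<theta>) \<le> B"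
    interpret A': delay_equation r d A' by (rule delay_equation.intro) (rule delay lin)+
    have B: "0 \<le> B" using init[of a] r_nonneg norm_ge_zero[of "\<phi> a"] by linarith
    have "onorm (A' k) \<le> onorm (A k) + 1" for k
    proof (rule onorm_le)
      fix y
      have "norm (A' k y) \<le> norm (A k y) + norm (A' k y - A k y)"
        using norm_triangle_ineq[of "A k y" "A' k y - A k y"] by simp
      also have "\<dots> \<le> onorm (A k) * norm y + 1 * norm y"
        using onorm[OF linear_A, of k y] close[of k y] mult_right_mono[OF eps(2), of "norm y"] by simp
      finally show "norm (A' k y) \<le> (onorm (A k) + 1) * norm y" by (simp add: algebra_simps)
    qed
    then have gain': "A'.gain \<le> gain + c"
      unfolding A'.gain_def gain_def c_def using sum_mono[of UNIV "\<lambda>k. onorm (A' k)" "\<lambda>k. onorm (A k) + 1"]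
      by (simp add: sum.distrib)
    have rate: "exp ((2 * \<gamma> + 1) * (s - b)) \<le> E" if "\<gamma> \<le> gain + c" "0 \<le> \<gamma>" "b \<le> s" "s \<le> b + L" for \<gamma> b s
      unfolding E_def using that by (auto intro!: mult_mono)
    have crude: "norm (\<phi> s) \<le> 2 * B * E" if "a \<le> s" "s \<le> a + L" for s
    proof -
      have "norm (\<phi> s) \<le> 2 * (B + 0) * exp ((2 * A'.gain + 1) * (s - a))"
        using sol by (rule A'.solution_bound) (use init that in auto)
      also have "\<dots> \<le> 2 * B * E"
        using rate[OF gain' A'.gain_nonneg, of a s] that B by (auto intro!: mult_left_mono)
      finally show ?thesis .
    qed
    have crude': "norm (\<phi> s) \<le> 2 * B * E" if "a - r \<le> s" "s \<le> a + L" for s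
    proof (cases "s \<le> a")
      case True
      have "1 \<le> E" unfolding E_def using gain_nonneg c L by simp
      then have "B * 1 \<le> B * E" using B by (intro mult_left_mono)
      then have "B \<le> 2 * B * E" using B by simp
      then show ?thesis using init[of s] True that by linarith
    qed (use crude that in auto)
    define \<phi>\<^sub>a where "\<phi>\<^sub>a t = \<phi> (t + a)" for t
    have sol\<^sub>a: "delay_solution r d A' (\<lambda>_. 0) 0 \<phi>\<^sub>a"
      using delay_solution_shift[OF sol, of "- a"] by (simp add: \<phi>\<^sub>a_def[abs_def])
    define h where "h t = (\<Sum>k\<in>UNIV. A' k (\<phi>\<^sub>a (t - d k)) - A k (\<phi>\<^sub>a (t - d k)))" for t
    have forced: "delay_solution r d A h 0 \<phi>\<^sub>a"
      using sol\<^sub>a by (simp add: delay_solution_def h_def sum_subtractf)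
    have "continuous_on {- r..0} \<phi>\<^sub>a" using sol\<^sub>a
      by (auto simp: delay_solution_def elim!: continuous_on_subset)
    then obtain \<psi> where \<psi>: "delay_solution r d A (\<lambda>_. 0) 0 \<psi>" "\<And>\<theta>. - r \<le> \<theta> \<Longrightarrow> \<theta> \<le> 0 \<Longrightarrow> \<psi> \<theta> = \<phi>\<^sub>a \<theta>"
      using solution_exists by blast
    have diff: "delay_solution r d A h 0 (\<lambda>t. \<phi>\<^sub>a t - \<psi> t)"
      using delay_solution_diff[OF forced \<psi>(1)] by simp
    have hb: "norm (h s) \<le> c * (\<epsilon> * (2 * B * E))" if "0 \<le> s" "s \<le> L" for s
    proof -
      have "norm (A' k (\<phi>\<^sub>a (s - d k)) - A k (\<phi>\<^sub>a (s - d k))) \<le> \<epsilon> * (2 * B * E)" for k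
        by (rule order_trans[OF close mult_left_mono])
           (use crude'[of "s - d k + a"] delay[of k] that eps in \<open>auto simp: \<phi>\<^sub>a_def\<close>)
      then have "norm (h s) \<le> (\<Sum>k\<in>(UNIV::'k set). \<epsilon> * (2 * B * E))"
        unfolding h_def by (intro sum_norm_le) auto
      then show ?thesis by (simp add: c_def)
    qed
    have db: "norm (\<phi>\<^sub>a s - \<psi> s) \<le> B / 4" if "0 \<le> s" "s \<le> L" for s
    proof -
      have "norm (\<phi>\<^sub>a s - \<psi> s) \<le> 2 * (0 + c * (\<epsilon> * (2 * B * E))) * exp ((2 * gain + 1) * (s - 0))"
        using diff by (rule solution_bound) (use \<psi>(2) hb that in auto)
      also have "\<dots> \<le> 2 * (0 + c * (\<epsilon> * (2 * B * E))) * E"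
        using rate[of gain 0 s] gain_nonneg c that B eps E by (intro mult_left_mono) auto
      also have "\<dots> = (16 * c * (E * E) * \<epsilon>) * (B / 4)" by (simp add: algebra_simps)
      also have "\<dots> \<le> 1 * (B / 4)" using eps(3) B by (intro mult_right_mono) auto
      finally show ?thesis by simp
    qed
    have sup: "(SUP \<theta>\<in>{- r..0}. norm (\<psi> \<theta>)) \<le> B"
      using r_nonneg init by (intro cSUP_least) (auto simp: \<psi>(2) \<phi>\<^sub>a_def)
    have nom: "norm (\<psi> s) \<le> B / 4" if "T \<le> s" for s
    proof -
      have "norm (\<psi> s) \<le> M * exp (- \<alpha> * s) * (SUP \<theta>\<in>{- r..0}. norm (\<psi> \<theta>))"
        using stable[OF \<psi>(1), of s] that T(1)[of T] by simp
      also have "\<dots> \<le> M * exp (- \<alpha> * s) * B" using sup M by (intro mult_left_mono) auto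
      also have "\<dots> \<le> 1/4 * B" using T(2)[OF that] B by (intro mult_right_mono)
      finally show ?thesis by simp
    qed
    have "norm (\<phi> t) \<le> B / 2" if "a + L - r \<le> t" "t \<le> a + L"
    proof -
      have s: "T \<le> t - a" "t - a \<le> L" using that by (auto simp: L_def)
      then have "norm (\<psi> (t - a)) \<le> B / 4" "norm (\<phi>\<^sub>a (t - a) - \<psi> (t - a)) \<le> B / 4"
        using nom db T(1)[of T] by auto
      moreover have "norm (\<phi>\<^sub>a (t - a)) \<le> norm (\<phi>\<^sub>a (t - a) - \<psi> (t - a)) + norm (\<psi> (t - a))"
        using norm_triangle_ineq[of "\<phi>\<^sub>a (t - a) - \<psi> (t - a)" "\<psi> (t - a)"] by simp
      ultimately show ?thesis by (simp add: \<phi>\<^sub>a_def)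
    qed
    then show "(a \<le> t \<and> t \<le> a + L \<longrightarrow> norm (\<phi> t) \<le> 2 * E * B) \<and>
        (a + L - r \<le> t \<and> t \<le> a + L \<longrightarrow> norm (\<phi> t) \<le> B / 2)"
      using crude by (simp add: mult_ac)
  qed
qed

text \<open>
  Iterating the contraction halves the bound on the history over each successive window. Only decay to
  zero is recorded, for solutions that start at an arbitrary time \<open>a\<close>.
\<close>
lemma stability_robust:
  assumes "0 < M" "0 < \<alpha>"
    and "\<And>\<phi> t. delay_solution r d A (\<lambda>_. 0) 0 \<phi> \<Longrightarrow> 0 \<le> t \<Longrightarrow>
      norm (\<phi> t) \<le> M * exp (- \<alpha> * t) * (SUP \<theta>\<in>{- r..0}. norm (\<phi> \<theta>))"
  obtains \<epsilon> where "0 < \<epsilon>"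
    and "\<And>A' \<phi> a. (\<And>k. bounded_linear (A' k)) \<Longrightarrow> (\<And>k y. norm (A' k y - A k y) \<le> \<epsilon> * norm y) \<Longrightarrow>
      delay_solution r d A' (\<lambda>_. 0) a \<phi> \<Longrightarrow> (\<phi> \<longlongrightarrow> 0) at_top"
proof -
  obtain \<epsilon> L E where eps: "0 < \<epsilon>" "0 < L" "0 < E"
    and contr: "\<And>A' \<phi> a B t. (\<And>k. bounded_linear (A' k)) \<Longrightarrow> (\<And>k y. norm (A' k y - A k y) \<le> \<epsilon> * norm y) \<Longrightarrow>
      delay_solution r d A' (\<lambda>_. 0) a \<phi> \<Longrightarrow> (\<And>\<theta>. a - r \<le> \<theta> \<Longrightarrow> \<theta> \<le> a \<Longrightarrow> norm (\<phi> \<theta>) \<le> B) \<Longrightarrow>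
      (a \<le> t \<and> t \<le> a + L \<longrightarrow> norm (\<phi> t) \<le> E * B) \<and> (a + L - r \<le> t \<and> t \<le> a + L \<longrightarrow> norm (\<phi> t) \<le> B / 2)"
    using perturbed_contraction[OF assms] by blast
  show thesis
  proof (rule that[OF eps(1)])
    fix A' \<phi> a
    assume A': "\<And>k. bounded_linear (A' k)" "\<And>k y. norm (A' k y - A k y) \<le> \<epsilon> * norm y"
      and sol: "delay_solution r d A' (\<lambda>_. 0) a \<phi>"
    have "continuous_on {a - r..a} \<phi>" using sol
      by (auto simp: delay_solution_def elim!: continuous_on_subset)
    then have "compact (\<phi> ` {a - r..a})" by (intro compact_continuous_image) auto
    then obtain B where B: "\<And>x. x \<in> \<phi> ` {a - r..a} \<Longrightarrow> norm x \<le> B"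
      using compact_imp_bounded bounded_iff by metis
    have "norm (\<phi> a) \<le> B" by (rule B) (use r_nonneg in auto)
    then have B0: "0 \<le> B" using norm_ge_zero order_trans by blast
    have sol_n: "delay_solution r d A' (\<lambda>_. 0) (a + n * L) \<phi>" for n :: nat
      using sol by (rule delay_solution_mono) (use eps in simp)
    have window: "norm (\<phi> \<theta>) \<le> B / 2 ^ n" if "a + n * L - r \<le> \<theta>" "\<theta> \<le> a + n * L" for n :: nat and \<theta>
      using that
    proof (induction n arbitrary: \<theta>)
      case 0
      then show ?case using B by auto
    next
      case (Suc n)
      have "(a + n * L) + L - r \<le> \<theta> \<and> \<theta> \<le> (a + n * L) + L \<longrightarrow> norm (\<phi> \<theta>) \<le> B / 2 ^ n / 2"
        using contr[OF A' sol_n[of n] Suc.IH] by blast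
      then show ?case using Suc.prems by (simp add: algebra_simps)
    qed
    have bound: "norm (\<phi> t) \<le> E * (B / 2 ^ n)" if "a + n * L \<le> t" "t \<le> a + n * L + L" for t and n :: nat
      using contr[OF A' sol_n[of n] window, of n t] that by blast
    have late: "norm (\<phi> t) \<le> E * B * (1/2) ^ n" if "a + n * L \<le> t" for t and n :: nat
    proof -
      define m where "m = nat \<lfloor>(t - a) / L\<rfloor>"
      have q: "real n \<le> (t - a) / L" using that eps by (simp add: field_simps)
      then have "int n \<le> \<lfloor>(t - a) / L\<rfloor>" by (simp add: le_floor_iff)
      then have nm: "n \<le> m" and m: "real m = of_int \<lfloor>(t - a) / L\<rfloor>" by (auto simp: m_def)
      have "real m \<le> (t - a) / L" "(t - a) / L \<le> real m + 1" unfolding m by linarith+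
      then have "a + m * L \<le> t" "t \<le> a + m * L + L" using eps by (auto simp: field_simps)
      from bound[OF this] have "norm (\<phi> t) \<le> E * B * (1/2) ^ m" by (simp add: power_divide)
      also have "\<dots> \<le> E * B * (1/2) ^ n"
        using nm B0 eps by (intro mult_left_mono power_decreasing) auto
      finally show ?thesis .
    qed
    show "(\<phi> \<longlongrightarrow> 0) at_top"
    proof (rule tendstoI)
      fix e :: real assume e: "0 < e"
      have "(\<lambda>n. E * B * (1/2) ^ n) \<longlonglongrightarrow> E * B * 0"
        by (intro tendsto_intros LIMSEQ_realpow_zero) auto
      then have "\<forall>\<^sub>F n in sequentially. E * B * (1/2) ^ n < e"
        using e by (intro order_tendstoD(2)) auto
      then obtain n :: nat where n: "E * B * (1/2) ^ n < e" by (auto simp: eventually_sequentially)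
      show "\<forall>\<^sub>F t in at_top. dist (\<phi> t) 0 < e"
        using eventually_ge_at_top[of "a + n * L"]
        by eventually_elim (use late[of n] n in fastforce)
    qed
  qed
qed

end

text \<open>
  Continuity in \<open>w\<close> at each fixed vector suffices, because a linear map is controlled by its values on
  the finite basis.
\<close>
lemma uniformly_small_perturbation:
  fixes A :: "'w::{topological_space,zero} \<Rightarrow> 'k::finite \<Rightarrow> 'e::euclidean_space \<Rightarrow> 'e"
  assumes lin: "\<And>w k. bounded_linear (A w k)"
    and cont: "\<And>k y. continuous_on UNIV (\<lambda>w. A w k y)"
    and eps: "0 < \<epsilon>"
  obtains W where "open W" "0 \<in> W" "\<And>w k y. w \<in> W \<Longrightarrow> norm (A w k y - A 0 k y) \<le> \<epsilon> * norm y"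
proof -
  define s where "s w = (\<Sum>k\<in>UNIV. \<Sum>b\<in>Basis. norm (A w k b - A 0 k b))" for w
  define W where "W = {w. s w < \<epsilon>}"
  have "continuous_on UNIV s" unfolding s_def by (intro continuous_intros cont)
  then have "open W" unfolding W_def by (intro open_Collect_less) auto
  moreover have "0 \<in> W" using eps by (simp add: W_def s_def)
  moreover have "norm (A w k y - A 0 k y) \<le> \<epsilon> * norm y" if "w \<in> W" for w k y
  proof -
    have bl: "linear (\<lambda>y. A w k y - A 0 k y)"
      by (intro bounded_linear.linear bounded_linear_sub lin)
    have "A w k y - A 0 k y = (\<Sum>b\<in>Basis. (y \<bullet> b) *\<^sub>R (A w k b - A 0 k b))"
      using linear_sum[OF bl, of "\<lambda>b. (y \<bullet> b) *\<^sub>R b" Basis] linear_cmul[OF bl]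
      by (simp add: euclidean_representation)
    then have "norm (A w k y - A 0 k y) \<le> (\<Sum>b\<in>Basis. norm y * norm (A w k b - A 0 k b))"
      by (auto intro!: sum_norm_le mult_right_mono Basis_le_norm)
    also have "\<dots> = norm y * (\<Sum>b\<in>Basis. norm (A w k b - A 0 k b))" by (simp add: sum_distrib_left)
    also have "(\<Sum>b\<in>Basis. norm (A w k b - A 0 k b)) \<le> s w"
      unfolding s_def by (rule member_le_sum) (auto intro!: sum_nonneg)
    then have "norm y * (\<Sum>b\<in>Basis. norm (A w k b - A 0 k b)) \<le> norm y * \<epsilon>"
      using that by (intro mult_left_mono) (auto simp: W_def)
    finally show ?thesis by (simp add: mult.commute)
  qed
  ultimately show thesis by (rule that)
qed

lemma stability_neighbourhood:
  fixes A :: "'w::{topological_space,zero} \<Rightarrow> 'k::finite \<Rightarrow> 'e::euclidean_space \<Rightarrow> 'e"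
  assumes delay: "\<And>k. 0 \<le> d k" "\<And>k. d k \<le> r"
    and lin: "\<And>w k. bounded_linear (A w k)"
    and cont: "\<And>k y. continuous_on UNIV (\<lambda>w. A w k y)"
    and stable: "exp_stable r {\<phi>. delay_solution r d (A 0) (\<lambda>_. 0) 0 \<phi>}"
  obtains W where "open W" "0 \<in> W"
    "\<And>w \<phi> a. w \<in> W \<Longrightarrow> delay_solution r d (A w) (\<lambda>_. 0) a \<phi> \<Longrightarrow> (\<phi> \<longlongrightarrow> 0) at_top"
proof -
  interpret delay_equation r d "A 0" by (rule delay_equation.intro) (rule delay lin)+
  obtain M \<alpha> where M: "0 < M" "0 < \<alpha>" and bound: "\<And>\<phi> t. delay_solution r d (A 0) (\<lambda>_. 0) 0 \<phi> \<Longrightarrow> 0 \<le> t \<Longrightarrow>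
      norm (\<phi> t) \<le> M * exp (- \<alpha> * t) * (SUP \<theta>\<in>{- r..0}. norm (\<phi> \<theta>))"
    using stable by (auto simp: exp_stable_def)
  obtain \<epsilon> where eps: "0 < \<epsilon>"
    and dec: "\<And>A' \<phi> a. (\<And>k. bounded_linear (A' k)) \<Longrightarrow> (\<And>k y. norm (A' k y - A 0 k y) \<le> \<epsilon> * norm y) \<Longrightarrow>
      delay_solution r d A' (\<lambda>_. 0) a \<phi> \<Longrightarrow> (\<phi> \<longlongrightarrow> 0) at_top"
    using stability_robust[OF M bound] by blast
  obtain W where "open W" "0 \<in> W" "\<And>w k y. w \<in> W \<Longrightarrow> norm (A w k y - A 0 k y) \<le> \<epsilon> * norm y"
    using uniformly_small_perturbation[of A, OF lin cont eps] by blast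
  then show thesis by (intro that[of W] dec[of "A _"] lin) auto
qed

section \<open>Derivatives of trajectories\<close>

context delay_equation
begin

text \<open>
  The derivative of a solution solves the differentiated equation, but only from time \<open>a + r\<close> on: before
  that, delayed values refer to the initial function, which need not be differentiable.
\<close>
lemma delay_solution_derivative:
  assumes sol: "delay_solution r d A g a \<phi>"
    and g': "\<And>t. (g has_vector_derivative g' t) (at t)"
  shows "delay_solution r d A g' (a + r) (\<lambda>t. (\<Sum>k\<in>UNIV. A k (\<phi> (t - d k))) + g t)"
    (is "delay_solution _ _ _ _ _ ?\<phi>'")
  unfolding delay_solution_def
proof safe
  have c: "continuous_on {a - r..} \<phi>" using sol by (simp add: delay_solution_def)
  have gc: "continuous_on S g" for S
    using has_vector_derivative_continuous[OF g'] by (intro continuous_at_imp_continuous_on) auto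
  have dc: "continuous_on {a..} (\<lambda>t. \<phi> (t - d k))" for k
    by (rule continuous_on_compose2[OF c]) (use delay[of k] in \<open>auto intro!: continuous_intros\<close>)
  have "continuous_on {a..} ?\<phi>'"
    by (intro continuous_intros gc bounded_linear.continuous_on[OF linear_A] dc)
  then show "continuous_on {a + r - r..} ?\<phi>'" by simp
  fix t assume t: "a + r \<le> t"
  have "((\<lambda>t. A k (\<phi> (t - d k))) has_vector_derivative A k (?\<phi>' (t - d k))) (at t within {a + r..})" for k
  proof (rule bounded_linear.has_vector_derivative[OF linear_A])
    have "(\<phi> has_vector_derivative ?\<phi>' (t - d k)) (at (t - d k) within {a..})"
      using sol t delay[of k] by (simp add: delay_solution_def)
    from has_vector_derivative_shift_atLeast[OF this]
    show "((\<lambda>t. \<phi> (t - d k)) has_vector_derivative ?\<phi>' (t - d k)) (at t within {a + r..})"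
      by (rule has_vector_derivative_within_subset) (use delay[of k] in auto)
  qed
  then show "(?\<phi>' has_vector_derivative (\<Sum>k\<in>UNIV. A k (?\<phi>' (t - d k))) + g' t) (at t within {a + r..})"
    by (intro has_vector_derivative_add has_vector_derivative_sum has_vector_derivative_at_within[OF g'])
qed

text \<open>
  The right-hand side of the equation for the derivative of order \<open>k\<close>, used as a total definition of
  the derivative of order \<open>k + 1\<close>. It is a genuine derivative from time \<open>k * r\<close> on.
\<close>
primrec solution_deriv :: "(nat \<Rightarrow> real \<Rightarrow> 'e) \<Rightarrow> (real \<Rightarrow> 'e) \<Rightarrow> nat \<Rightarrow> real \<Rightarrow> 'e" where
  "solution_deriv g \<phi> 0 = \<phi>"
| "solution_deriv g \<phi> (Suc k) = (\<lambda>t. (\<Sum>j\<in>UNIV. A j (solution_deriv g \<phi> k (t - d j))) + g k t)"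

context
  fixes g :: "nat \<Rightarrow> real \<Rightarrow> 'e" and \<phi> :: "real \<Rightarrow> 'e"
  assumes sol: "delay_solution r d A (g 0) 0 \<phi>"
    and smooth: "\<And>k t. (g k has_vector_derivative g (Suc k) t) (at t)"
begin

lemma delay_solution_solution_deriv:
  "delay_solution r d A (g k) (real k * r) (solution_deriv g \<phi> k)"
proof (induction k)
  case (Suc k)
  from delay_solution_derivative[OF Suc smooth] show ?case by (simp add: algebra_simps)
qed (use sol in simp)

lemma has_vector_derivative_solution_deriv:
  assumes "real k * r \<le> t"
  shows "(solution_deriv g \<phi> k has_vector_derivative solution_deriv g \<phi> (Suc k) t) (at t within {real k * r..})"
  using delay_solution_solution_deriv[of k] assms by (simp add: delay_solution_def)

text \<open>
  A differential operator with constant coefficients commutes with the delay equation. If it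
  annihilates the forcing, it turns a forced solution into an unforced one.
\<close>
lemma annihilated_forcing:
  assumes "\<And>t. (\<Sum>k\<le>n. c k *\<^sub>R g k t) = 0"
  shows "delay_solution r d A (\<lambda>_. 0) (real n * r) (\<lambda>t. \<Sum>k\<le>n. c k *\<^sub>R solution_deriv g \<phi> k t)"
proof -
  have "delay_solution r d A (g k) (real n * r) (solution_deriv g \<phi> k)" if "k \<in> {..n}" for k
    using delay_solution_solution_deriv that r_nonneg
    by (intro delay_solution_mono[OF delay_solution_solution_deriv]) (auto intro: mult_right_mono)
  from delay_solution_sum[where g=g and \<phi>="solution_deriv g \<phi>" and c=c and I="{..n}", OF this] show ?thesis
    by (simp add: assms)
qed

end

end

section \<open>Polynomials in a matrix and the Cayley--Hamilton theorem\<close>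

lemma matrix_power_mult_vector: "matrix_power A k *v y = (((*v) A) ^^ k) y"
  by (induction k arbitrary: y) (simp_all add: matrix_power_def matrix_vector_mul_assoc[symmetric])

lemma linear_funpow_mult_vector: "linear (((*v) A ^^ k) :: real^'n \<Rightarrow> real^'n::finite)"
  by (induction k) (auto simp: linear_id[unfolded id_def] intro: linear_compose[unfolded comp_def])

lemma sum_matrix_mult_vector: "(\<Sum>k\<in>I. M k) *v (y::real^'n) = (\<Sum>k\<in>I. M k *v y)"
  by (induction I rule: infinite_finite_induct) (simp_all add: matrix_vector_mult_add_rdistrib)

lemma poly_matrix_mult_vector:
  assumes "degree p \<le> N"
  shows "poly_matrix p A *v y = (\<Sum>k\<le>N. coeff p k *\<^sub>R ((*v) A ^^ k) y)"
proof -
  have "poly_matrix p A *v y = (\<Sum>k\<le>degree p. coeff p k *\<^sub>R ((*v) A ^^ k) y)"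
    unfolding poly_matrix_def
    by (simp add: sum_matrix_mult_vector scaleR_matrix_vector_assoc[symmetric] matrix_power_mult_vector)
  also have "\<dots> = (\<Sum>k\<le>N. coeff p k *\<^sub>R ((*v) A ^^ k) y)"
    using assms by (intro sum.mono_neutral_left) (auto simp: coeff_eq_0)
  finally show ?thesis .
qed

lemma poly_matrix_0 [simp]: "poly_matrix 0 A = 0"
  by (simp add: poly_matrix_def)

lemma poly_matrix_pCons:
  "poly_matrix (pCons a p) A *v y = a *\<^sub>R y + A *v (poly_matrix p A *v y)"
proof -
  have "poly_matrix (pCons a p) A *v y = (\<Sum>k\<le>Suc (degree p). coeff (pCons a p) k *\<^sub>R ((*v) A ^^ k) y)"
    by (rule poly_matrix_mult_vector) (rule degree_pCons_le)
  also have "\<dots> = a *\<^sub>R y + (\<Sum>k\<le>degree p. coeff p k *\<^sub>R (A *v ((*v) A ^^ k) y))"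
    by (subst sum.atMost_Suc_shift) simp
  also have "(\<Sum>k\<le>degree p. coeff p k *\<^sub>R (A *v ((*v) A ^^ k) y)) = A *v (poly_matrix p A *v y)"
    by (simp add: poly_matrix_mult_vector[OF order_refl] linear_sum[OF matrix_vector_mul_linear] matrix_vector_mult_scaleR)
  finally show ?thesis .
qed

lemma poly_matrix_add:
  "poly_matrix (p + q) A *v y = poly_matrix p A *v y + poly_matrix q A *v y"
proof -
  define N where "N = max (degree p) (degree q)"
  have "degree (p + q) \<le> N" "degree p \<le> N" "degree q \<le> N" by (auto simp: N_def degree_add_le_max)
  then show ?thesis by (simp add: poly_matrix_mult_vector[of _ N] scaleR_add_left sum.distrib)
qed

lemma poly_matrix_smult: "poly_matrix (smult a p) A *v y = a *\<^sub>R (poly_matrix p A *v y)"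
  by (simp add: poly_matrix_mult_vector[of _ "degree p"] degree_smult_le scaleR_sum_right)

lemma poly_matrix_sum:
  "poly_matrix (\<Sum>k\<in>I. p k) A *v y = (\<Sum>k\<in>I. poly_matrix (p k) A *v y)"
  by (induction I rule: infinite_finite_induct) (simp_all add: poly_matrix_add)

lemma poly_matrix_mult:
  "poly_matrix (p * q) A *v y = poly_matrix p A *v (poly_matrix q A *v y)"
  by (induction p) (simp_all add: poly_matrix_add poly_matrix_smult poly_matrix_pCons)

text \<open>
  Expansion along row \<open>j\<close> of the matrix in which row \<open>i\<close> has been replaced by row \<open>j\<close>: two equal rows
  unless \<open>i = j\<close>. This is the adjugate identity, valid over any commutative ring and used below for
  matrices of polynomials.
\<close>
lemma cofactor_expansion:
  fixes M :: "'a::comm_ring_1^'n^'n"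
  shows "(\<Sum>k\<in>UNIV. M $ j $ k * det (\<chi> r. if r = i then axis k 1 else M $ r)) = (if i = j then det M else 0)"
proof -
  have row: "M $ j = (\<Sum>k\<in>UNIV. M $ j $ k *s axis k 1)"
    by (simp add: basis_expansion)
  have "(\<Sum>k\<in>UNIV. M $ j $ k * det (\<chi> r. if r = i then axis k 1 else M $ r)) =
      (\<Sum>k\<in>UNIV. det (\<chi> r. if r = i then M $ j $ k *s axis k 1 else M $ r))"
    by (simp add: det_row_mul[symmetric])
  also have "\<dots> = det (\<chi> r. if r = i then \<Sum>k\<in>UNIV. M $ j $ k *s axis k 1 else M $ r)"
    by (rule det_linear_row_sum[symmetric]) simp
  also have "\<dots> = det (\<chi> r. if r = i then M $ j else M $ r)" by (simp only: row[symmetric])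
  also have "\<dots> = (if i = j then det M else 0)"
  proof (cases "i = j")
    case True
    then have "(\<chi> r. if r = i then M $ j else M $ r) = M" by (simp add: vec_eq_iff)
    then show ?thesis using True by simp
  next
    case False
    then show ?thesis by (auto simp: row_def intro!: det_identical_rows[of i j])
  qed
  finally show ?thesis .
qed

text \<open>
  Let a polynomial act on vectors by \<open>p \<sqdot> y = poly_matrix p A *v y\<close>. The entries of the characteristic
  matrix \<open>M\<close> satisfy \<open>\<Sum>j. M $ j $ k \<sqdot> e j = 0\<close> for each column \<open>k\<close>, since \<open>A\<close> maps \<open>e k\<close> to \<open>\<Sum>j. A $ j $ k *\<^sub>R e j\<close>.
  Multiplying this system by the adjugate leaves \<open>det M\<close> on each basis vector.
\<close>
theorem cayley_hamilton_vector: "poly_matrix (char_poly A) A *v y = 0"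
  for A :: "real^'n^'n::finite"
proof -
  define M :: "real poly^'n^'n" where "M = (\<chi> i j. (if i = j then [:0, 1:] else 0) - [:A $ i $ j:])"
  define a where "a i k = det (\<chi> r. if r = i then axis k 1 else M $ r)" for i k
  define e where "e j = (axis j 1 :: real^'n)" for j
  have const: "poly_matrix [:c:] A *v z = c *\<^sub>R z" and monic: "poly_matrix [:0, 1:] A *v z = A *v z" for c z
    by (simp_all add: poly_matrix_pCons)
  have entry: "poly_matrix (M $ j $ k) A *v e j = (if j = k then A *v e k else 0) - A $ j $ k *\<^sub>R e j" for j k
  proof -
    have "M $ j $ k + [:A $ j $ k:] = (if j = k then [:0, 1:] else 0)"
      by (simp only: M_def vec_lambda_beta diff_add_cancel)
    with poly_matrix_add[of "M $ j $ k" "[:A $ j $ k:]" A "e j"] have "poly_matrix (M $ j $ k) A *v e j + A $ j $ k *\<^sub>R e j = poly_matrix (if j = k then [:0, 1:] else 0) A *v e j"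
      by (simp only: const)
    then show ?thesis by (auto simp: monic algebra_simps)
  qed
  have column: "(\<Sum>j\<in>UNIV. A $ j $ k *\<^sub>R e j) = A *v e k" for k
    unfolding e_def matrix_vector_mult_basis
    by (simp add: column_def vec_eq_iff axis_def if_distrib sum.delta cong: if_cong)
  have kill: "(\<Sum>j\<in>UNIV. poly_matrix (M $ j $ k) A *v e j) = 0" for k
    by (simp add: entry sum_subtractf column)
  have basis: "poly_matrix (char_poly A) A *v e i = 0" for i
  proof -
    have "poly_matrix (char_poly A) A *v e i = (\<Sum>j\<in>UNIV. poly_matrix (if i = j then det M else 0) A *v e j)"
      by (simp add: char_poly_def M_def if_distrib[of "\<lambda>p. poly_matrix p A *v _"] cong: if_cong)
    also have "\<dots> = (\<Sum>j\<in>UNIV. poly_matrix (\<Sum>k\<in>UNIV. a i k * M $ j $ k) A *v e j)"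
      by (simp add: cofactor_expansion[symmetric] a_def mult.commute)
    also have "\<dots> = (\<Sum>k\<in>UNIV. poly_matrix (a i k) A *v (\<Sum>j\<in>UNIV. poly_matrix (M $ j $ k) A *v e j))"
      by (simp only: poly_matrix_sum poly_matrix_mult linear_sum[OF matrix_vector_mul_linear]) (rule sum.swap)
    also have "\<dots> = 0" by (simp add: kill)
    finally show ?thesis .
  qed
  have "y = (\<Sum>i\<in>UNIV. y $ i *\<^sub>R e i)"
    by (simp add: e_def vec_eq_iff axis_def if_distrib sum.delta cong: if_cong)
  then have "poly_matrix (char_poly A) A *v y = (\<Sum>i\<in>UNIV. y $ i *\<^sub>R (poly_matrix (char_poly A) A *v e i))"
    by (metis (no_types, lifting) linear_sum[OF matrix_vector_mul_linear] matrix_vector_mult_scaleR sum.cong)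
  then show ?thesis by (simp add: basis)
qed

lemma degree_char_poly_le: "degree (char_poly A) \<le> CARD('n)" for A :: "real^'n^'n::finite"
proof -
  have deg1: "degree ((if i = j then [:0, 1:] else 0) - [:A $ i $ j:]) \<le> 1" for i j :: 'n
    by (rule degree_diff_le) auto
  have "degree (\<Prod>i\<in>UNIV. (if i = p i then [:0, 1:] else 0) - [:A $ i $ p i:]) \<le> CARD('n)" for p :: "'n \<Rightarrow> 'n"
    using degree_prod_sum_le[of UNIV "\<lambda>i. (if i = p i then [:0, 1:] else 0) - [:A $ i $ p i:]"]
      sum_mono[of UNIV "\<lambda>i. degree ((if i = p i then [:0, 1:] else 0) - [:A $ i $ p i:])" "\<lambda>_. 1"] deg1
    by (simp add: o_def)
  then show ?thesis unfolding char_poly_def det_def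
    by (intro degree_sum_le order_trans[OF degree_mult_le])
       (auto simp: finite_permutations sign_def)
qed

section \<open>The internal model\<close>

text \<open>
  Full rank of the controllability matrix makes its columns a basis; \<open>c\<close> is the coordinate functional of
  the column of index \<open>m\<close>.
\<close>
lemma controllable_dual_functional:
  fixes A :: "real^'n^'n::finite"
  assumes ctrl: "controllable A b" and m: "m < CARD('n)"
  obtains c :: "real^'n \<Rightarrow> real" where "linear c" "\<And>k. k < m \<Longrightarrow> c (((*v) A ^^ k) b) = 0" "c (((*v) A ^^ m) b) = 1"
proof -
  define u where "u k = ((*v) A ^^ k) b" for k
  define V where "V = u ` {..<CARD('n)}"
  have dim: "dim V = CARD('n)"
    using ctrl by (simp add: controllable_def V_def u_def matrix_power_mult_vector image_def Bex_def conj_commute)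
  have le: "card V \<le> CARD('n)" unfolding V_def using card_image_le[of "{..<CARD('n)}" u] by simp
  have ind: "independent V"
    by (rule card_le_dim_spanning[of V V]) (use dim le in \<open>auto simp: V_def intro: span_base\<close>)
  have "CARD('n) \<le> card V" using dim dim_le_card'[of V] by (simp add: V_def)
  then have inj: "inj_on u {..<CARD('n)}"
    using le by (intro eq_card_imp_inj_on) (auto simp: V_def)
  obtain c where c: "linear c" "\<forall>x\<in>V. c x = (if x = u m then 1 else (0::real))"
    using linear_independent_extend[OF ind, of "\<lambda>x. if x = u m then 1 else 0"] by blast
  show thesis
  proof (rule that[OF c(1)])
    fix k assume "k < m"
    then have "u k \<in> V" "u k \<noteq> u m" using m inj by (auto simp: V_def inj_on_def)
    then show "c (((*v) A ^^ k) b) = 0" using c(2) by (auto simp: u_def)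
  next
    have "u m \<in> V" using m by (auto simp: V_def)
    then show "c (((*v) A ^^ m) b) = 1" using c(2) by (auto simp: u_def)
  qed
qed

lemma degree_minimal_poly_pos:
  assumes "is_minimal_poly f S" shows "0 < degree f"
proof (rule ccontr)
  assume "\<not> 0 < degree f"
  then obtain a where "f = [:a:]" using degree_eq_zeroE by blast
  moreover have "lead_coeff f = 1" using assms by (simp add: is_minimal_poly_def)
  ultimately have "f = [:1:]" by simp
  then have "poly_matrix f S *v y = y" for y by (simp add: poly_matrix_pCons)
  then have "y = 0" for y :: "real^'a" using assms by (metis is_minimal_poly_def matrix_vector_mult_0)
  from this[of "axis undefined 1"] show False by simp
qed

text \<open>
  The input \<open>e\<close> is recovered from the state \<open>\<zeta>\<close> of the pair \<open>(\<beta>, \<sigma>)\<close>. Choose \<open>c\<close> with \<open>c (\<beta>\<^sup>k \<sigma>) = 0\<close> for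
  \<open>k < n - 1\<close> and \<open>c (\<beta>\<^sup>n\<^sup>-\<^sup>1 \<sigma>) = 1\<close>. Then \<open>c \<zeta>\<close> has relative degree \<open>n\<close>: its derivative of order \<open>k\<close> is
  \<open>c (\<beta>\<^sup>k \<zeta>)\<close> for \<open>k < n\<close>, and \<open>c (\<beta>\<^sup>n \<zeta>) + e\<close> for \<open>k = n\<close>. Applying the operator \<open>f(d/dt)\<close> gives
  \<open>c (f(\<beta>) \<zeta>) + e\<close>, which is \<open>e\<close> by Cayley and Hamilton. So \<open>e\<close> decays whenever \<open>f(d/dt) \<zeta>\<close> does.
\<close>
lemma internal_model_error_decays:
  fixes \<beta> :: "real^'b^'b::finite" and \<zeta> :: "nat \<Rightarrow> real \<Rightarrow> real^'b"
  defines "f \<equiv> char_poly \<beta>"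
  assumes ctrl: "controllable \<beta> \<sigma>" and monic: "lead_coeff f = 1" and pos: "0 < degree f" and r: "0 \<le> r"
    and deriv: "\<And>k t. real k * r \<le> t \<Longrightarrow> (\<zeta> k has_vector_derivative \<zeta> (Suc k) t) (at t within {real k * r..})"
    and model: "\<And>t. 0 \<le> t \<Longrightarrow> \<zeta> (Suc 0) t = \<beta> *v \<zeta> 0 t + e t *\<^sub>R \<sigma>"
    and decay: "((\<lambda>t. \<Sum>k\<le>degree f. coeff f k *\<^sub>R \<zeta> k t) \<longlongrightarrow> 0) at_top"
  shows "(e \<longlongrightarrow> 0) at_top"
proof -
  define n where "n = degree f"
  have n: "0 < n" "n - 1 < CARD('b)" using pos degree_char_poly_le[of \<beta>] by (auto simp: n_def f_def)
  obtain c where c: "linear c" "\<And>k. k < n - 1 \<Longrightarrow> c (((*v) \<beta> ^^ k) \<sigma>) = 0" "c (((*v) \<beta> ^^ (n - 1)) \<sigma>) = (1::real)"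
    using controllable_dual_functional[OF ctrl n(2)] by metis
  have bl: "bounded_linear c" using c(1) by (simp add: linear_conv_bounded_linear)
  have blb: "bounded_linear (\<lambda>y. c (((*v) \<beta> ^^ k) y))" for k
    using linear_compose[OF linear_funpow_mult_vector[of k \<beta>] c(1)]
    by (simp add: linear_conv_bounded_linear o_def)
  have step: "c (\<zeta> (Suc k) t) = c (((*v) \<beta> ^^ Suc k) (\<zeta> 0 t)) + e t * c (((*v) \<beta> ^^ k) \<sigma>)"
    if eq: "\<And>s. real k * r \<le> s \<Longrightarrow> c (\<zeta> k s) = c (((*v) \<beta> ^^ k) (\<zeta> 0 s))" and t: "real k * r \<le> t" for k t
  proof (rule vector_derivative_unique_within)
    show "at t within {real k * r..} \<noteq> bot"
      using t by (rule at_within_atLeast_neq_bot)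
    show "((\<lambda>t. c (\<zeta> k t)) has_vector_derivative c (\<zeta> (Suc k) t)) (at t within {real k * r..})"
      by (rule bounded_linear.has_vector_derivative[OF bl deriv[OF t]])
    have t0: "0 \<le> t" using t r by (meson mult_nonneg_nonneg of_nat_0_le_iff order_trans)
    have "(\<zeta> 0 has_vector_derivative \<zeta> (Suc 0) t) (at t within {real k * r..})"
      using deriv[of 0 t] t0 r by (auto intro: has_vector_derivative_within_subset[of _ _ _ "{0..}"])
    then have "((\<lambda>t. c (((*v) \<beta> ^^ k) (\<zeta> 0 t))) has_vector_derivative c (((*v) \<beta> ^^ k) (\<zeta> (Suc 0) t)))
        (at t within {real k * r..})"
      by (rule bounded_linear.has_vector_derivative[OF blb])
    then have "((\<lambda>t. c (\<zeta> k t)) has_vector_derivative c (((*v) \<beta> ^^ k) (\<zeta> (Suc 0) t))) (at t within {real k * r..})"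
      by (rule has_vector_derivative_transform[rotated 2]) (use t eq in auto)
    moreover have "c (((*v) \<beta> ^^ k) (\<zeta> (Suc 0) t)) = c (((*v) \<beta> ^^ Suc k) (\<zeta> 0 t)) + e t * c (((*v) \<beta> ^^ k) \<sigma>)"
      using linear_add[OF bounded_linear.linear[OF blb[of k]]] linear_cmul[OF bounded_linear.linear[OF blb[of k]]]
      by (simp add: model[OF t0] funpow_swap1)
    ultimately show "((\<lambda>t. c (\<zeta> k t)) has_vector_derivative
        c (((*v) \<beta> ^^ Suc k) (\<zeta> 0 t)) + e t * c (((*v) \<beta> ^^ k) \<sigma>)) (at t within {real k * r..})" by simp
  qed
  have low: "c (\<zeta> k t) = c (((*v) \<beta> ^^ k) (\<zeta> 0 t))" if "k < n" "real k * r \<le> t" for k t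
    using that
  proof (induction k arbitrary: t)
    case (Suc k)
    have "real k * r \<le> real (Suc k) * r" using r by (intro mult_right_mono) auto
    then have "real k * r \<le> t" using Suc.prems by linarith
    then show ?case using step[of k t] Suc c(2)[of k] by auto
  qed simp
  have top: "c (\<zeta> n t) = c (((*v) \<beta> ^^ n) (\<zeta> 0 t)) + e t" if "real n * r \<le> t" for t
  proof -
    have "real (n - 1) * r \<le> real n * r" using r by (intro mult_right_mono) auto
    then show ?thesis using step[of "n - 1" t] low[of "n - 1"] that n c(3) by auto
  qed
  have error: "c (\<Sum>k\<le>n. coeff f k *\<^sub>R \<zeta> k t) = e t" if t: "real n * r \<le> t" for t
  proof -
    have late: "real k * r \<le> t" if "k \<le> n" for k
      using t that r by (meson mult_right_mono of_nat_le_iff order_trans)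
    have "c (\<Sum>k\<le>n. coeff f k *\<^sub>R \<zeta> k t) = (\<Sum>k\<le>n. coeff f k * c (\<zeta> k t))"
      by (simp add: linear_sum[OF c(1)] linear_cmul[OF c(1)])
    also have "\<dots> = (\<Sum>k\<le>n. coeff f k * c (((*v) \<beta> ^^ k) (\<zeta> 0 t)) + (if k = n then e t else 0))"
      using monic late by (intro sum.cong) (auto simp: low top n_def[symmetric] algebra_simps)
    also have "\<dots> = c (\<Sum>k\<le>n. coeff f k *\<^sub>R ((*v) \<beta> ^^ k) (\<zeta> 0 t)) + e t"
      by (simp add: sum.distrib linear_sum[OF c(1)] linear_cmul[OF c(1)])
    also have "(\<Sum>k\<le>n. coeff f k *\<^sub>R ((*v) \<beta> ^^ k) (\<zeta> 0 t)) = 0"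
      using cayley_hamilton_vector[of \<beta>] poly_matrix_mult_vector[of f n \<beta>] by (simp add: n_def f_def)
    finally show ?thesis by (simp add: linear_0[OF c(1)])
  qed
  have "((\<lambda>t. c (\<Sum>k\<le>n. coeff f k *\<^sub>R \<zeta> k t)) \<longlongrightarrow> c 0) at_top"
    using bounded_linear.tendsto[OF bl decay] by (simp add: n_def)
  then have "((\<lambda>t. c (\<Sum>k\<le>n. coeff f k *\<^sub>R \<zeta> k t)) \<longlongrightarrow> 0) at_top" by (simp add: linear_0[OF c(1)])
  then show ?thesis
    by (rule Lim_transform_eventually)
       (auto simp: eventually_at_top_linorder intro!: exI[of _ "real n * r"] error)
qed

lemma has_vector_derivative_delay:
  fixes f :: "real \<Rightarrow> 'e::real_normed_vector"
  assumes "(f has_vector_derivative D) (at (t - s))"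
  shows "((\<lambda>t. f (t - s)) has_vector_derivative D) (at t)"
proof -
  have "((\<lambda>t. t - s) has_vector_derivative 1) (at t)"
    by (auto intro!: derivative_eq_intros)
  from vector_diff_chain_at[OF this assms] show ?thesis by (simp add: o_def)
qed

text \<open>
  The regulation principle. The forcing is driven by \<open>v' = S v\<close>, and the characteristic polynomial \<open>f\<close> of
  \<open>\<beta>\<close> annihilates \<open>S\<close>. So \<open>f(d/dt)\<close> kills the forcing, turns the trajectory into an unforced and hence
  decaying one, and the copy of the internal model contained in the trajectory translates this decay
  into decay of its input \<open>e\<close>.
\<close>
lemma (in delay_equation) internal_model_regulates:
  fixes S :: "real^'q^'q::finite" and \<beta> :: "real^'b^'b::finite" and Z :: "'e \<Rightarrow> real^'b"
  assumes decay: "\<And>\<phi> a. delay_solution r d A (\<lambda>_. 0) a \<phi> \<Longrightarrow> (\<phi> \<longlongrightarrow> 0) at_top"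
    and v: "\<And>t. (v has_vector_derivative S *v v t) (at t)"
    and minimal: "is_minimal_poly (char_poly \<beta>) S" and ctrl: "controllable \<beta> \<sigma>"
    and lin: "bounded_linear p" "bounded_linear q" "bounded_linear Z"
    and sol: "delay_solution r d A (\<lambda>t. p (v t) + q (v (t - \<theta>))) 0 \<phi>"
    and model: "\<And>t. 0 \<le> t \<Longrightarrow> ((\<lambda>t. Z (\<phi> t)) has_vector_derivative \<beta> *v Z (\<phi> t) + e t *\<^sub>R \<sigma>) (at t within {0..})"
  shows "(e \<longlongrightarrow> 0) at_top"
proof -
  define f where "f = char_poly \<beta>"
  define v' where "v' k t = ((*v) S ^^ k) (v t)" for k t
  define g where "g k t = p (v' k t) + q (v' k (t - \<theta>))" for k t
  have v': "(v' k has_vector_derivative v' (Suc k) t) (at t)" for k t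
    unfolding v'_def funpow_Suc_right comp_def
    by (rule bounded_linear.has_vector_derivative[OF _ v]) (simp add: linear_funpow_mult_vector flip: linear_conv_bounded_linear)
  have smooth: "(g k has_vector_derivative g (Suc k) t) (at t)" for k t
    unfolding g_def
    by (intro has_vector_derivative_add lin[THEN bounded_linear.has_vector_derivative] has_vector_derivative_delay v')
  have sol0: "delay_solution r d A (g 0) 0 \<phi>" using sol by (simp add: g_def[abs_def] v'_def)
  have ann_v: "(\<Sum>k\<le>degree f. coeff f k *\<^sub>R v' k t) = 0" for t
    using poly_matrix_mult_vector[of f "degree f" S "v t"] minimal by (simp add: v'_def is_minimal_poly_def f_def)
  have ann: "(\<Sum>k\<le>degree f. coeff f k *\<^sub>R g k t) = 0" for t
  proof -
    have "(\<Sum>k\<le>degree f. coeff f k *\<^sub>R g k t) =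
        p (\<Sum>k\<le>degree f. coeff f k *\<^sub>R v' k t) + q (\<Sum>k\<le>degree f. coeff f k *\<^sub>R v' k (t - \<theta>))"
      by (simp add: g_def lin[THEN bounded_linear.linear, THEN linear_sum] lin[THEN bounded_linear.linear, THEN linear_cmul]
          scaleR_add_right sum.distrib)
    then show ?thesis by (simp add: ann_v lin[THEN bounded_linear.linear, THEN linear_0])
  qed
  define \<zeta> where "\<zeta> k t = Z (solution_deriv g \<phi> k t)" for k t
  have "((\<lambda>t. \<Sum>k\<le>degree f. coeff f k *\<^sub>R solution_deriv g \<phi> k t) \<longlongrightarrow> 0) at_top"
    by (rule decay) (rule annihilated_forcing[OF sol0 smooth ann])
  from bounded_linear.tendsto[OF lin(3) this]
  have "((\<lambda>t. \<Sum>k\<le>degree f. coeff f k *\<^sub>R \<zeta> k t) \<longlongrightarrow> 0) at_top"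
    by (simp add: \<zeta>_def lin(3)[THEN bounded_linear.linear, THEN linear_sum]
        lin(3)[THEN bounded_linear.linear, THEN linear_cmul] lin(3)[THEN bounded_linear.linear, THEN linear_0])
  moreover have deriv: "(\<zeta> k has_vector_derivative \<zeta> (Suc k) t) (at t within {real k * r..})" if "real k * r \<le> t" for k t
    unfolding \<zeta>_def
    by (rule bounded_linear.has_vector_derivative[OF lin(3) has_vector_derivative_solution_deriv[OF sol0 smooth that]])
  moreover have "\<zeta> (Suc 0) t = \<beta> *v \<zeta> 0 t + e t *\<^sub>R \<sigma>" if "0 \<le> t" for t
  proof (rule vector_derivative_unique_within)
    show "at t within {0..} \<noteq> bot" using that by (rule at_within_atLeast_neq_bot)
    show "(\<zeta> 0 has_vector_derivative \<zeta> (Suc 0) t) (at t within {0..})" using deriv[of 0 t] that by simp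
    show "(\<zeta> 0 has_vector_derivative \<beta> *v \<zeta> 0 t + e t *\<^sub>R \<sigma>) (at t within {0..})"
      using model[OF that] by (simp add: \<zeta>_def[abs_def])
  qed
  ultimately show ?thesis
    using minimal unfolding f_def
    by (intro internal_model_error_decays[OF ctrl _ degree_minimal_poly_pos[OF minimal] r_nonneg, of \<zeta> e])
       (auto simp: is_minimal_poly_def)
qed

section \<open>Block matrices\<close>

lemma sum_pair_index: "(\<Sum>p\<in>(UNIV::('a::finite \<times> 'b::finite) set). f p) = (\<Sum>a\<in>UNIV. \<Sum>b\<in>UNIV. f (a, b))"
  by (simp add: sum.cartesian_product flip: UNIV_Times_UNIV)

lemma block_diag_mult_nth: "(block_diag M *v y) $ (i, a) = (M i *v (\<chi> b. y $ (i, b))) $ a"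
  by (simp add: matrix_vector_mult_def block_diag_def sum_pair_index if_distrib if_distribR sum.If_cases
      sum.delta' cong: if_cong)

lemma block_diag_vec_mult_nth: "(block_diag_vec s *v y) $ (i, a) = s i $ a * y $ i"
  by (simp add: matrix_vector_mult_def block_diag_vec_def if_distrib if_distribR sum.delta' cong: if_cong)

lemma block_column_mult_nth: "(block_column M *v y) $ (i, a) = (M i *v y) $ a"
  by (simp add: matrix_vector_mult_def block_column_def)

lemma kron_mat_1_left_nth: "((mat 1 \<otimes>\<^sub>k M) *v y) $ (i, a) = (M *v (\<chi> b. y $ (i, b))) $ a"
  by (simp add: matrix_vector_mult_def kron_def mat_def sum_pair_index if_distrib if_distribR sum.If_cases cong: if_cong)

lemma kron_mat_1_right_nth: "((M \<otimes>\<^sub>k mat 1) *v y) $ (i, a) = (\<Sum>l\<in>UNIV. M $ i $ l * y $ (l, a))"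
  by (simp add: matrix_vector_mult_def kron_def mat_def sum_pair_index if_distrib if_distribR sum.delta' mult.assoc cong: if_cong)

lemma has_vector_derivative_vecI:
  fixes f :: "real \<Rightarrow> real^'n::finite"
  assumes "\<And>i. ((\<lambda>t. f t $ i) has_vector_derivative D $ i) (at t within S)"
  shows "(f has_vector_derivative D) (at t within S)"
  unfolding has_vector_derivative_def
proof (subst has_derivative_componentwise_within, rule ballI)
  fix b :: "real^'n" assume "b \<in> Basis"
  then obtain i where b: "b = axis i 1" by (auto simp: Basis_vec_def)
  show "((\<lambda>t. f t \<bullet> b) has_derivative (\<lambda>s. (s *\<^sub>R D) \<bullet> b)) (at t within S)"
    using assms[of i] by (simp add: b inner_axis has_vector_derivative_def)
qed

section \<open>The communication graph\<close>

lemma exp_stable_subset: "exp_stable r Y \<Longrightarrow> X \<subseteq> Y \<Longrightarrow> exp_stable r X"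
  unfolding exp_stable_def by (fast dest: subsetD)

text \<open>
  Maximum principle. Extend \<open>y\<close> by the value 0 at the root. The equation at a node says that its value is
  a weighted mean of the values at its predecessors, so the set where the maximum is attained is closed
  under predecessors and, following the tree backwards, contains the root. Hence the maximum is 0, and
  the same holds for \<open>- y\<close>.
\<close>
lemma matH_kernel_trivial:
  assumes graph: "weighted_digraph P" and tree: "directed_spanning_tree (edges P) T None"
    and ker: "matH P *v y = 0"
  shows "y = 0"
proof -
  have nonneg: "0 \<le> adj P $ i $ j" for i j
    using graph by (cases "(j, i) \<in> edges P") (auto simp: weighted_digraph_def intro: less_imp_le)
  have upper: "y $ i \<le> 0" if ker: "matH P *v y = 0" for y i
  proof -
    define Y where "Y j = (case j of None \<Rightarrow> 0 | Some i \<Rightarrow> y $ i)" for j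
    have balance: "(\<Sum>l\<in>UNIV. adj P $ Some i $ l * (Y (Some i) - Y l)) = 0" for i
    proof -
      have "(matH P *v y) $ i = (\<Sum>j\<in>UNIV. (if i = j then (\<Sum>l\<in>UNIV. adj P $ Some i $ l) * y $ i else - (adj P $ Some i $ Some j * y $ j)))"
        by (auto simp: matH_def matrix_vector_mult_def intro!: sum.cong)
      also have "\<dots> = (\<Sum>j\<in>UNIV. (if i = j then (\<Sum>l\<in>UNIV. adj P $ Some i $ l) * y $ i else 0) - adj P $ Some i $ Some j * y $ j)"
        using graph by (intro sum.cong) (auto simp: weighted_digraph_def)
      also have "\<dots> = (\<Sum>l\<in>UNIV. adj P $ Some i $ l) * y $ i - (\<Sum>j\<in>UNIV. adj P $ Some i $ Some j * y $ j)"
        by (simp add: sum_subtractf)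
      also have "(\<Sum>j\<in>UNIV. adj P $ Some i $ Some j * y $ j) = (\<Sum>l\<in>UNIV. adj P $ Some i $ l * Y l)"
        by (simp add: UNIV_option_conv sum.reindex Y_def)
      finally show ?thesis using ker by (simp add: Y_def right_diff_distrib sum_subtractf sum_distrib_right)
    qed
    define m where "m = Max (range Y)"
    have le: "Y j \<le> m" for j by (simp add: m_def)
    have up: "Y l = m" if "Y (Some i) = m" "(l, Some i) \<in> edges P" for i l
    proof -
      have "\<forall>l\<in>UNIV. adj P $ Some i $ l * (Y (Some i) - Y l) = 0"
        using balance[of i] by (subst (asm) sum_nonneg_eq_0_iff) (auto simp: that(1) intro!: mult_nonneg_nonneg nonneg le)
      then have "adj P $ Some i $ l * (Y (Some i) - Y l) = 0" by blast
      moreover have "adj P $ Some i $ l > 0" using graph that(2) by (simp add: weighted_digraph_def)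
      ultimately show ?thesis using that(1) by simp
    qed
    have "m \<in> range Y" unfolding m_def by (rule Max_in) auto
    then obtain j where "Y j = m" by auto
    have "(None, j) \<in> T\<^sup>*" using tree by (simp add: directed_spanning_tree_def)
    then have "Y j = m \<longrightarrow> Y None = m"
    proof (induction rule: rtrancl_induct)
      case (step k l)
      have "(k, l) \<in> edges P" using step(2) tree by (auto simp: directed_spanning_tree_def)
      moreover from this obtain i where "l = Some i" using graph by (cases l) (auto simp: weighted_digraph_def)
      ultimately show ?case using up step(3) by auto
    qed simp
    then have "m = 0" using \<open>Y j = m\<close> by (simp add: Y_def)
    then show ?thesis using le[of "Some i"] by (simp add: Y_def)
  qed
  have "matH P *v (- y) = 0" using ker linear_neg[OF matrix_vector_mul_linear, of "matH P" y] by simp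
  from upper[OF ker] upper[OF this] show ?thesis by (simp add: vec_eq_iff order_antisym)
qed

text \<open>
  In stacked form \<open>e\<^sub>v = (H \<otimes> I) e\<close>. The reference term fits because the rows of \<open>H\<close> sum to the
  weights of the edges from the root.
\<close>
lemma stacked_error_nth:
  assumes graph: "weighted_digraph P" and e: "\<And>i. e i = barC P w i *v x i t + refF P *v v"
  shows "(tilC P w *v col x t + tilF P *v v) $ (i, a) = (matH P *v (\<chi> l. e l $ a)) $ i"
proof -
  have row: "(\<Sum>l\<in>UNIV. matH P $ i $ l) = adj P $ Some i $ None"
  proof -
    have "(\<Sum>l\<in>UNIV. matH P $ i $ l) = (\<Sum>l\<in>UNIV. (if i = l then (\<Sum>j\<in>UNIV. adj P $ Some i $ j) else 0) - adj P $ Some i $ Some l)"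
      using graph by (intro sum.cong) (auto simp: matH_def weighted_digraph_def)
    also have "\<dots> = (\<Sum>j\<in>UNIV. adj P $ Some i $ j) - (\<Sum>l\<in>UNIV. adj P $ Some i $ Some l)"
      by (simp add: sum_subtractf)
    also have "\<dots> = adj P $ Some i $ None" by (simp add: UNIV_option_conv sum.reindex)
    finally show ?thesis .
  qed
  have "(tilC P w *v col x t) $ (i, a) = (\<Sum>l\<in>UNIV. matH P $ i $ l * (barC P w l *v x l t) $ a)"
    by (simp add: tilC_def matrix_vector_mul_assoc[symmetric] kron_mat_1_right_nth block_diag_mult_nth col_def)
  moreover have "(tilF P *v v) $ (i, a) = adj P $ Some i $ None * (refF P *v v) $ a"
    by (simp add: tilF_def vec_kron_def Delta_def matrix_vector_mult_def if_distribR sum_distrib_left mult.assoc cong: if_cong)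
  ultimately show ?thesis
    unfolding row[symmetric]
    by (simp add: matrix_vector_mult_def[of "matH P"] e sum_distrib_right sum.distrib distrib_left)
qed

lemma multi_agent_is_auxiliary:
  assumes "multi_agent_system P w v x u y y0 e" "error_signal P w v (col x) ev"
  shows "auxiliary_system P w v (col x) (col u) ev"
  unfolding auxiliary_system_def
proof (intro conjI allI impI assms)
  show "exosystem P v" using assms by (simp add: multi_agent_system_def)
  show "continuous_on {- tau P..0} (col x)"
    using assms unfolding multi_agent_system_def col_def[abs_def]
    by (intro continuous_on_vec_lambda continuous_on_component) auto
  fix t :: real assume t: "0 \<le> t"
  show "(col x has_vector_derivative tilA P w *v col x t + tilB P w *v col u (t - tcon P) + tilE P w *v v t) (at t within {0..})"
  proof (rule has_vector_derivative_vecI)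
    fix r :: "'a \<times> 'b"
    obtain i a where r: "r = (i, a)" by (cases r)
    have "(x i has_vector_derivative barA P w i *v x i t + barB P w i *v u i (t - tcon P) + barE P w i *v v t) (at t within {0..})"
      using assms t by (auto simp: multi_agent_system_def)
    from bounded_linear.has_vector_derivative[OF bounded_linear_vec_nth this, of a]
    show "((\<lambda>t. col x t $ r) has_vector_derivative (tilA P w *v col x t + tilB P w *v col u (t - tcon P) + tilE P w *v v t) $ r) (at t within {0..})"
      by (simp add: r col_def tilA_def tilB_def tilE_def block_diag_mult_nth block_column_mult_nth)
  qed
qed

text \<open>
  Stacking the agents gives a trajectory of the auxiliary system, which settles stability. Regulation
  passes from \<open>e\<^sub>v\<close> to the individual errors through the inverse of \<open>H\<close>.
\<close>
lemma cooperative_from_auxiliary: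
  assumes delays: "0 \<le> tcon P" "0 \<le> tcom P" and graph: "weighted_digraph P"
    and tree: "directed_spanning_tree (edges P) T None"
    and aux: "solves_robust_output_regulation P law"
  shows "solves_cooperative_robust_output_regulation P law"
proof -
  have sub: "{\<lambda>t. (col x t, \<eta> t) | x \<eta> u y y0 e ev.
       multi_agent_system P 0 (\<lambda>_. 0) x u y y0 e \<and>
       error_signal P 0 (\<lambda>_. 0) (col x) ev \<and> law (col x) ev \<eta> (col u)} \<subseteq>
     {\<lambda>t. (x t, \<eta> t) | x \<eta> u ev. auxiliary_system P 0 (\<lambda>_. 0) x u ev \<and> law x ev \<eta> u}"
    using multi_agent_is_auxiliary by blast
  have stable: "exp_stable (tau P) {\<lambda>t. (col x t, \<eta> t) | x \<eta> u y y0 e ev.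
       multi_agent_system P 0 (\<lambda>_. 0) x u y y0 e \<and>
       error_signal P 0 (\<lambda>_. 0) (col x) ev \<and> law (col x) ev \<eta> (col u)}"
    by (rule exp_stable_subset[OF conjunct1[OF aux[unfolded solves_robust_output_regulation_def]] sub])
  obtain W where W: "open W" "0 \<in> W" and reg: "\<And>w v x \<eta> u ev. w \<in> W \<Longrightarrow> auxiliary_system P w v x u ev \<Longrightarrow>
      law x ev \<eta> u \<Longrightarrow> (ev \<longlongrightarrow> 0) at_top"
    using conjunct2[OF aux[unfolded solves_robust_output_regulation_def]] by metis
  obtain G where G: "G ** matH P = mat 1"
    using matH_kernel_trivial[OF graph tree] matrix_left_invertible_ker[of "matH P"] by metis
  have "(e i \<longlongrightarrow> 0) at_top"
    if w: "w \<in> W" and mas: "multi_agent_system P w v x u y y0 e"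
      and err: "error_signal P w v (col x) ev" and law: "law (col x) ev \<eta> (col u)"
    for w v x \<eta> u y y0 e ev i
  proof (rule vec_tendstoI)
    fix a
    have ev: "(ev \<longlongrightarrow> 0) at_top" using reg[OF w multi_agent_is_auxiliary[OF mas err] law] .
    have "((\<lambda>t. (G *v (\<chi> l. ev t $ (l, a))) $ i) \<longlongrightarrow> (G *v (\<chi> l. 0 $ (l, a))) $ i) at_top"
      by (intro tendsto_intros bounded_linear.tendsto[OF matrix_vector_mul_bounded_linear] ev)
    then have "((\<lambda>t. (G *v (\<chi> l. ev t $ (l, a))) $ i) \<longlongrightarrow> 0) at_top"
      by (simp add: zero_vec_def[symmetric])
    moreover have "(G *v (\<chi> l. ev t $ (l, a))) $ i = e i t $ a" if t: "0 \<le> t" for t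
    proof -
      have t': "- tau P \<le> t" using t delays by (simp add: tau_def)
      have "e l t = barC P w l *v x l t + refF P *v v t" for l
        using mas t' by (simp add: multi_agent_system_def)
      from stacked_error_nth[where e="\<lambda>l. e l t" and x=x and t=t, OF graph this]
      have "(\<chi> l. ev t $ (l, a)) = matH P *v (\<chi> l. e l t $ a)"
        using err t' by (simp add: error_signal_def vec_eq_iff)
      then show ?thesis by (simp add: matrix_vector_mul_assoc G)
    qed
    then have "\<forall>\<^sub>F t in at_top. (G *v (\<chi> l. ev t $ (l, a))) $ i = e i t $ a"
      using eventually_ge_at_top[of 0] by (rule eventually_mono[rotated])
    ultimately show "((\<lambda>t. e i t $ a) \<longlongrightarrow> 0 $ a) at_top"
      by (simp add: Lim_transform_eventually)
  qed
  then show ?thesis unfolding solves_cooperative_robust_output_regulation_def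
    by (intro conjI stable exI[of _ W] W) blast
qed

section \<open>Closed loops as delay equations\<close>

text \<open>
  Both closed loops have the delays \<open>0\<close>, \<open>tcon\<close>, \<open>tcom\<close> and \<open>tcon + tcom\<close>. The index records which of the
  two basic delays occur.
\<close>
definition loop_delay :: "('N::finite, 'n::finite, 'm::finite, 'p::finite, 'q::finite) plant \<Rightarrow> bool \<times> bool \<Rightarrow> real" where
  "loop_delay P k = (if fst k then tcon P else 0) + (if snd k then tcom P else 0)"

lemma sum_bool_pair: "(\<Sum>k\<in>UNIV. f k) = f (False, False) + f (True, False) + f (False, True) + f (True, True)"
  for f :: "bool \<times> bool \<Rightarrow> 'a::comm_monoid_add"
  by (simp add: sum_pair_index UNIV_bool ac_simps)

lemma loop_delay_bounds:
  assumes "0 \<le> tcon P" "0 \<le> tcom P"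
  shows "0 \<le> loop_delay P k" "loop_delay P k \<le> tau P"
  using assms by (auto simp: loop_delay_def tau_def)

lemma continuous_on_block_diag_mult:
  assumes "\<And>i a b. continuous_on S (\<lambda>w. M w i $ a $ b)"
  shows "continuous_on S (\<lambda>w. block_diag (M w) *v y)"
proof -
  have "(\<lambda>w. block_diag (M w) *v y) = (\<lambda>w. \<chi> r. (M w (fst r) *v (\<chi> b. y $ (fst r, b))) $ snd r)"
    by (auto simp: vec_eq_iff block_diag_mult_nth)
  moreover have "continuous_on S (\<lambda>w. \<chi> r. (M w (fst r) *v (\<chi> b. y $ (fst r, b))) $ snd r)"
    unfolding matrix_vector_mult_def by (intro continuous_on_vec_lambda) (auto intro!: continuous_intros assms)
  ultimately show ?thesis by (simp only:)
qed

lemma continuous_on_tilde: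
  shows continuous_on_tilA: "continuous_on UNIV (\<lambda>w. tilA P w *v y)"
    and continuous_on_tilB: "continuous_on UNIV (\<lambda>w. tilB P w *v y')"
    and continuous_on_tilC: "continuous_on UNIV (\<lambda>w. tilC P w *v y)"
  unfolding tilA_def tilB_def tilC_def matrix_vector_mul_assoc[symmetric] barA_def barB_def barC_def
  by (intro bounded_linear.continuous_on[OF matrix_vector_mul_bounded_linear] continuous_on_block_diag_mult;
      intro continuous_intros)+

text \<open>
  Each component of \<open>e\<^sub>v\<close> drives its own copy of \<open>(\<beta>, \<sigma>)\<close>, so the regulation principle applies
  component by component. Its error is \<open>e\<^sub>v\<close> delayed by \<open>tcom\<close>.
\<close>
lemma loop_regulates:
  fixes P :: "('N::finite, 'n::finite, 'm::finite, 'p::finite, 'q::finite) plant"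
    and G1 :: "real^('p \<times> 'b::finite)^('p \<times> 'b)" and \<pi> :: "'e::euclidean_space \<Rightarrow> real^('N \<times> ('p \<times> 'b))"
  assumes delays: "0 \<le> tcon P" "0 \<le> tcom P"
    and im: "minimal_p_copy_internal_model (exoS P) G1 G2"
    and exo: "exosystem P v"
    and linA: "\<And>k. bounded_linear (A k)"
    and decay: "\<And>\<phi> a. delay_solution (tau P) (loop_delay P) A (\<lambda>_. 0) a \<phi> \<Longrightarrow> (\<phi> \<longlongrightarrow> 0) at_top"
    and lin: "bounded_linear p" "bounded_linear q" "bounded_linear \<pi>"
    and sol: "delay_solution (tau P) (loop_delay P) A (\<lambda>t. p (v t) + q (v (t - tcom P))) 0 \<phi>"
    and dyn: "internal_model_dynamics P G1 G2 ev (\<lambda>t. \<pi> (\<phi> t))"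
  shows "(ev \<longlongrightarrow> 0) at_top"
proof (rule vec_tendstoI)
  fix r :: "'N \<times> 'p"
  obtain i j where r: "r = (i, j)" by (cases r)
  obtain \<beta> :: "real^'b^'b" and \<sigma> where \<beta>: "is_minimal_poly (char_poly \<beta>) (exoS P)" "controllable \<beta> \<sigma>"
    and G: "G1 = block_diag (\<lambda>_. \<beta>)" "G2 = block_diag_vec (\<lambda>_. \<sigma>)"
    using im by (auto simp: minimal_p_copy_internal_model_def)
  interpret delay_equation "tau P" "loop_delay P" A
    by (rule delay_equation.intro) (rule loop_delay_bounds delays linA)+
  define Z where "Z z = (\<chi> b. z $ (i, (j, b)))" for z :: "real^('N \<times> ('p \<times> 'b))"
  have Z: "bounded_linear Z"
    by (auto simp: Z_def[abs_def] vec_eq_iff intro!: linearI simp flip: linear_conv_bounded_linear)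
  have "((\<lambda>t. ev (t - tcom P) $ r) \<longlongrightarrow> 0) at_top"
  proof (rule internal_model_regulates[OF decay _ \<beta> lin(1,2) _ sol])
    show "(v has_vector_derivative exoS P *v v t) (at t)" for t
      using exo by (simp add: exosystem_def)
    show "bounded_linear (\<lambda>y. Z (\<pi> y))" using bounded_linear_compose[OF Z lin(3)] .
    fix t :: real assume "0 \<le> t"
    then have "((\<lambda>t. \<pi> (\<phi> t)) has_vector_derivative
        (mat 1 \<otimes>\<^sub>k G1) *v \<pi> (\<phi> t) + (mat 1 \<otimes>\<^sub>k G2) *v ev (t - tcom P)) (at t within {0..})"
      using dyn by (simp add: internal_model_dynamics_def)
    from bounded_linear.has_vector_derivative[OF Z this]
    show "((\<lambda>t. Z (\<pi> (\<phi> t))) has_vector_derivative \<beta> *v Z (\<pi> (\<phi> t)) + ev (t - tcom P) $ r *\<^sub>R \<sigma>) (at t within {0..})"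
      by (rule has_vector_derivative_eq_rhs)
         (simp add: Z_def vec_eq_iff kron_mat_1_left_nth G block_diag_mult_nth block_diag_vec_mult_nth r)
  qed
  then have "((\<lambda>t. ev (t + tcom P - tcom P) $ r) \<longlongrightarrow> 0) at_top"
    by (rule filterlim_compose)
       (simp add: filterlim_tendsto_add_at_top[OF tendsto_const filterlim_ident] add.commute[of _ "tcom P"])
  then show "((\<lambda>t. ev t $ r) \<longlongrightarrow> 0 $ r) at_top" by simp
qed

lemma continuous_on_history:
  fixes x :: "real \<Rightarrow> 'a::real_normed_vector"
  assumes "continuous_on {- r..0} x" "\<And>t. 0 \<le> t \<Longrightarrow> (x has_vector_derivative x' t) (at t within {0..})" "0 \<le> r"
  shows "continuous_on {- r..} x"
proof -
  have "continuous_on {0..} x"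
    using assms(2) by (auto simp: continuous_on_eq_continuous_within intro: has_vector_derivative_continuous)
  then have "continuous_on ({- r..0} \<union> {0..}) x" using assms(1) by (intro continuous_on_closed_Un) auto
  moreover have "{- r..0} \<union> {0..} = {- r..}" using assms(3) by auto
  ultimately show ?thesis by simp
qed

section \<open>State feedback\<close>

text \<open>
  The nested conditional lists the coefficients of the closed loop in \<open>(x, z)\<close> for the delays \<open>0\<close>,
  \<open>tcon\<close>, \<open>tcom\<close> and \<open>tau\<close>. The input reaches the plant after \<open>tcon\<close>, which delays the feedback of \<open>z\<close> by
  \<open>tcon\<close> and that of \<open>x\<close>, already delayed by \<open>tcom\<close>, by \<open>tau\<close>.
\<close>
definition "state_loop P G1 G2 Kx Kz w k y =
  (if k = (False, False) then (tilA P w *v fst y, (mat 1 \<otimes>\<^sub>k G1) *v snd y)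
   else if k = (True, False) then (tilB P w *v (Kz *v snd y), 0)
   else if k = (False, True) then (0, (mat 1 \<otimes>\<^sub>k G2) *v (tilC P w *v fst y))
   else (tilB P w *v (Kx *v fst y), 0))"

lemma linear_state_loop: "bounded_linear (state_loop P G1 G2 Kx Kz w k)"
  unfolding linear_conv_bounded_linear[symmetric]
  by (rule linearI) (auto simp: state_loop_def matrix_vector_right_distrib matrix_vector_mult_scaleR)

lemma continuous_state_loop: "continuous_on UNIV (\<lambda>w. state_loop P G1 G2 Kx Kz w k y)"
proof -
  obtain a b where k: "k = (a, b)" by (cases k)
  show ?thesis unfolding k
    by (cases a; cases b)
       (auto simp: state_loop_def intro!: continuous_on_Pair continuous_on_const continuous_on_tilde
          bounded_linear.continuous_on[OF matrix_vector_mul_bounded_linear])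
qed

lemma state_loop_solution:
  fixes P :: "('N::finite, 'n::finite, 'm::finite, 'p::finite, 'q::finite) plant"
  assumes delays: "0 \<le> tcon P" "0 \<le> tcom P"
    and aux: "auxiliary_system P w v x u ev" and law: "dynamic_state_feedback P G1 G2 Kx Kz x ev z u"
  shows "delay_solution (tau P) (loop_delay P) (state_loop P G1 G2 Kx Kz w)
    (\<lambda>t. (tilE P w *v v t, 0) + (0, (mat 1 \<otimes>\<^sub>k G2) *v (tilF P *v v (t - tcom P)))) 0 (\<lambda>t. (x t, z t))"
  unfolding delay_solution_def
proof (intro conjI allI impI)
  have dx: "(x has_vector_derivative tilA P w *v x t + tilB P w *v u (t - tcon P) + tilE P w *v v t) (at t within {0..})"
    and dz: "(z has_vector_derivative (mat 1 \<otimes>\<^sub>k G1) *v z t + (mat 1 \<otimes>\<^sub>k G2) *v ev (t - tcom P)) (at t within {0..})"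
    if "0 \<le> t" for t
    using aux law that
    by (simp_all add: auxiliary_system_def dynamic_state_feedback_def internal_model_dynamics_def)
  have tau: "0 \<le> tau P" using delays by (simp add: tau_def)
  have "continuous_on {- tau P..} x" "continuous_on {- tau P..} z"
    using aux law
    by (auto intro!: continuous_on_history dx dz tau
        simp: auxiliary_system_def dynamic_state_feedback_def internal_model_dynamics_def)
  then show "continuous_on {0 - tau P..} (\<lambda>t. (x t, z t))" by (simp add: continuous_on_Pair)
  fix t :: real assume t: "0 \<le> t"
  have u: "u (t - tcon P) = Kx *v x (t - tau P) + Kz *v z (t - tcon P)"
    using law t by (simp add: dynamic_state_feedback_def state_feedback_def tau_def algebra_simps)
  have e: "ev (t - tcom P) = tilC P w *v x (t - tcom P) + tilF P *v v (t - tcom P)"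
    using aux t delays by (simp add: auxiliary_system_def error_signal_def tau_def)
  show "((\<lambda>t. (x t, z t)) has_vector_derivative
      (\<Sum>k\<in>UNIV. state_loop P G1 G2 Kx Kz w k (x (t - loop_delay P k), z (t - loop_delay P k))) +
      ((tilE P w *v v t, 0) + (0, (mat 1 \<otimes>\<^sub>k G2) *v (tilF P *v v (t - tcom P))))) (at t within {0..})"
    by (rule has_vector_derivative_eq_rhs[OF has_vector_derivative_Pair[OF dx[OF t] dz[OF t]]])
       (simp add: sum_bool_pair state_loop_def loop_delay_def u e matrix_vector_right_distrib tau_def algebra_simps)
qed

text \<open>
  The converse direction at \<open>w = 0\<close>, \<open>v = 0\<close>: every unforced solution of the delay equation is a
  trajectory of the nominal closed loop, so that the assumed stability bound applies to it.
\<close>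
lemma state_loop_trajectory:
  assumes "0 \<le> tcon P" "0 \<le> tcom P"
    and sol: "delay_solution (tau P) (loop_delay P) (state_loop P G1 G2 Kx Kz 0) (\<lambda>_. 0) 0 \<phi>"
  shows "\<exists>x z u ev. \<phi> = (\<lambda>t. (x t, z t)) \<and>
    augmented_system P G1 G2 0 (\<lambda>_. 0) x z u ev \<and> state_feedback P Kx Kz x z u"
proof -
  define x where "x t = fst (\<phi> t)" for t
  define z where "z t = snd (\<phi> t)" for t
  define u where "u t = Kx *v x (t - tcom P) + Kz *v z t" for t
  define ev where "ev t = tilC P 0 *v x t" for t
  have c: "continuous_on {- tau P..0} \<phi>"
    using sol by (auto simp: delay_solution_def elim!: continuous_on_subset)
  have "(\<phi> has_vector_derivative (tilA P 0 *v x t + tilB P 0 *v u (t - tcon P),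
      (mat 1 \<otimes>\<^sub>k G1) *v z t + (mat 1 \<otimes>\<^sub>k G2) *v ev (t - tcom P))) (at t within {0..})" if "0 \<le> t" for t
  proof -
    have "(\<phi> has_vector_derivative (\<Sum>k\<in>UNIV. state_loop P G1 G2 Kx Kz 0 k (\<phi> (t - loop_delay P k))) + 0) (at t within {0..})"
      using sol that by (simp add: delay_solution_def)
    then show ?thesis
      by (rule has_vector_derivative_eq_rhs)
         (simp add: sum_bool_pair state_loop_def loop_delay_def u_def ev_def x_def z_def matrix_vector_right_distrib algebra_simps)
  qed
  note d = bounded_linear.has_vector_derivative[OF bounded_linear_fst this]
    bounded_linear.has_vector_derivative[OF bounded_linear_snd this]
  have "augmented_system P G1 G2 0 (\<lambda>_. 0) x z u ev"
    using d c unfolding augmented_system_def auxiliary_system_def internal_model_dynamics_def exosystem_def error_signal_def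
    by (auto simp: x_def[abs_def] z_def[abs_def] ev_def intro!: continuous_intros)
  moreover have "state_feedback P Kx Kz x z u" by (simp add: state_feedback_def u_def)
  moreover have "\<phi> = (\<lambda>t. (x t, z t))" by (simp add: x_def z_def)
  ultimately show ?thesis by blast
qed

lemma state_feedback_robust:
  fixes P :: "('N::finite, 'n::finite, 'm::finite, 'p::finite, 'q::finite) plant"
    and G1 :: "real^('p \<times> 'b::finite)^('p \<times> 'b)"
  assumes delays: "0 \<le> tcon P" "0 \<le> tcom P"
    and im: "minimal_p_copy_internal_model (exoS P) G1 G2"
    and stab: "state_feedback_stabilizes P G1 G2 Kx Kz"
  shows "solves_robust_output_regulation P (dynamic_state_feedback P G1 G2 Kx Kz)"
proof -
  have nominal: "exp_stable (tau P) {\<lambda>t. (x t, \<eta> t) | x \<eta> u ev.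
      auxiliary_system P 0 (\<lambda>_. 0) x u ev \<and> dynamic_state_feedback P G1 G2 Kx Kz x ev \<eta> u}"
    by (rule exp_stable_subset[OF stab[unfolded state_feedback_stabilizes_def]])
       (auto simp: augmented_system_def dynamic_state_feedback_def)
  have stable: "exp_stable (tau P) {\<phi>. delay_solution (tau P) (loop_delay P) (state_loop P G1 G2 Kx Kz 0) (\<lambda>_. 0) 0 \<phi>}"
    by (rule exp_stable_subset[OF stab[unfolded state_feedback_stabilizes_def]])
       (use state_loop_trajectory[OF delays] in blast)
  obtain W where W: "open W" "0 \<in> W"
    and decay: "\<And>w \<phi> a. w \<in> W \<Longrightarrow>
      delay_solution (tau P) (loop_delay P) (state_loop P G1 G2 Kx Kz w) (\<lambda>_. 0) a \<phi> \<Longrightarrow> (\<phi> \<longlongrightarrow> 0) at_top"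
    using stability_neighbourhood[OF loop_delay_bounds[OF delays] linear_state_loop continuous_state_loop stable] by metis
  have "(ev \<longlongrightarrow> 0) at_top"
    if w: "w \<in> W" and aux: "auxiliary_system P w v x u ev"
      and law: "dynamic_state_feedback P G1 G2 Kx Kz x ev z u" for w v x z u ev
  proof (rule loop_regulates[OF delays im _ linear_state_loop decay[OF w] _ _ _ state_loop_solution[OF delays aux law]])
    show "exosystem P v" using aux by (simp add: auxiliary_system_def)
    show "bounded_linear (\<lambda>y. (tilE P w *v y, 0 :: real^('N \<times> ('p \<times> 'b))))"
      "bounded_linear (\<lambda>y. (0 :: real^('N \<times> 'n), (mat 1 \<otimes>\<^sub>k G2) *v (tilF P *v y)))"
      by (auto intro!: bounded_linear_Pair bounded_linear_zero bounded_linear_compose[OF matrix_vector_mul_bounded_linear])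
    show "bounded_linear (snd :: (real^('N \<times> 'n)) \<times> (real^('N \<times> ('p \<times> 'b))) \<Rightarrow> _)" by (rule bounded_linear_snd)
    show "internal_model_dynamics P G1 G2 ev (\<lambda>t. snd (x t, z t))"
      using law by (simp add: dynamic_state_feedback_def)
  qed
  then show ?thesis unfolding solves_robust_output_regulation_def
    by (intro conjI nominal exI[of _ W] W) blast
qed

section \<open>Output feedback\<close>

text \<open>
  The closed loop in \<open>(x, z, \<xi>)\<close>. The plant state enters the controller only through the error signal,
  hence with the delay \<open>tcom\<close>; the delay \<open>tau\<close> occurs only in the term with \<open>\<zeta> = col(z, \<xi>)\<close>.
\<close>
definition "output_loop P G1 G2 K1 K2 S1 S2 S3 w k y =
  (if k = (False, False) then
     (tilA P w *v fst y, (mat 1 \<otimes>\<^sub>k G1) *v fst (snd y), S1 *v snd (snd y))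
   else if k = (True, False) then (tilB P w *v (K1 *v fst (snd y) + K2 *v snd (snd y)), 0, 0)
   else if k = (False, True) then
     (0, (mat 1 \<otimes>\<^sub>k G2) *v (tilC P w *v fst y), S2 *v (tilC P w *v fst y))
   else (0, 0, S3 *v col2 (fst (snd y)) (snd (snd y))))"

lemma col2_linear:
  "col2 (a + b) (c + d) = col2 a c + col2 b d" "col2 (s *\<^sub>R a) (s *\<^sub>R c) = s *\<^sub>R col2 a c"
  by (auto simp: col2_def vec_eq_iff split: sum.split)

lemma linear_output_loop: "bounded_linear (output_loop P G1 G2 K1 K2 S1 S2 S3 w k)"
  unfolding linear_conv_bounded_linear[symmetric]
  by (rule linearI)
     (auto simp: output_loop_def matrix_vector_right_distrib matrix_vector_mult_scaleR col2_linear scaleR_add_right)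

lemma continuous_output_loop: "continuous_on UNIV (\<lambda>w. output_loop P G1 G2 K1 K2 S1 S2 S3 w k y)"
proof -
  obtain a b where k: "k = (a, b)" by (cases k)
  show ?thesis unfolding k
    by (cases a; cases b)
       (auto simp: output_loop_def intro!: continuous_on_Pair continuous_on_const continuous_on_tilde
          bounded_linear.continuous_on[OF matrix_vector_mul_bounded_linear])
qed

lemma output_loop_solution:
  fixes P :: "('N::finite, 'n::finite, 'm::finite, 'p::finite, 'q::finite) plant"
  assumes delays: "0 \<le> tcon P" "0 \<le> tcom P"
    and aux: "auxiliary_system P w v x u ev" and law: "dynamic_output_feedback P G1 G2 K1 K2 S1 S2 S3 x ev \<eta> u"
  shows "delay_solution (tau P) (loop_delay P) (output_loop P G1 G2 K1 K2 S1 S2 S3 w)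
    (\<lambda>t. (tilE P w *v v t, 0, 0) +
      (0, (mat 1 \<otimes>\<^sub>k G2) *v (tilF P *v v (t - tcom P)), S2 *v (tilF P *v v (t - tcom P)))) 0 (\<lambda>t. (x t, \<eta> t))"
proof -
  define z where "z t = fst (\<eta> t)" for t
  define \<xi> where "\<xi> t = snd (\<eta> t)" for t
  have \<eta>: "\<eta> = (\<lambda>t. (z t, \<xi> t))" by (simp add: z_def \<xi>_def)
  have ofb: "output_feedback P K1 K2 S1 S2 S3 ev z \<xi> u" and imd: "internal_model_dynamics P G1 G2 ev z"
    using law by (simp_all add: dynamic_output_feedback_def z_def[abs_def] \<xi>_def[abs_def])
  have dx: "(x has_vector_derivative tilA P w *v x t + tilB P w *v u (t - tcon P) + tilE P w *v v t) (at t within {0..})"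
    and dz: "(z has_vector_derivative (mat 1 \<otimes>\<^sub>k G1) *v z t + (mat 1 \<otimes>\<^sub>k G2) *v ev (t - tcom P)) (at t within {0..})"
    and d\<xi>: "(\<xi> has_vector_derivative S1 *v \<xi> t + S2 *v ev (t - tcom P) + S3 *v col2 (z (t - tau P)) (\<xi> (t - tau P)))
      (at t within {0..})"
    if "0 \<le> t" for t
    using aux ofb imd that
    by (simp_all add: auxiliary_system_def output_feedback_def internal_model_dynamics_def)
  have tau: "0 \<le> tau P" using delays by (simp add: tau_def)
  have "continuous_on {- tau P..} x" "continuous_on {- tau P..} z" "continuous_on {- tau P..} \<xi>"
    using aux ofb imd
    by (auto intro!: continuous_on_history dx dz d\<xi> tau
        simp: auxiliary_system_def output_feedback_def internal_model_dynamics_def)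
  then have cont: "continuous_on {0 - tau P..} (\<lambda>t. (x t, z t, \<xi> t))" by (simp add: continuous_on_Pair)
  show ?thesis unfolding delay_solution_def \<eta>
  proof (intro conjI allI impI cont)
    fix t :: real assume t: "0 \<le> t"
    have u: "u (t - tcon P) = K1 *v z (t - tcon P) + K2 *v \<xi> (t - tcon P)"
      using ofb t by (simp add: output_feedback_def)
    have e: "ev (t - tcom P) = tilC P w *v x (t - tcom P) + tilF P *v v (t - tcom P)"
      using aux t delays by (simp add: auxiliary_system_def error_signal_def tau_def)
    show "((\<lambda>t. (x t, z t, \<xi> t)) has_vector_derivative
        (\<Sum>k\<in>UNIV. output_loop P G1 G2 K1 K2 S1 S2 S3 w k
           (x (t - loop_delay P k), z (t - loop_delay P k), \<xi> (t - loop_delay P k))) +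
        ((tilE P w *v v t, 0, 0) +
         (0, (mat 1 \<otimes>\<^sub>k G2) *v (tilF P *v v (t - tcom P)), S2 *v (tilF P *v v (t - tcom P))))) (at t within {0..})"
      by (rule has_vector_derivative_eq_rhs
            [OF has_vector_derivative_Pair[OF dx[OF t] has_vector_derivative_Pair[OF dz[OF t] d\<xi>[OF t]]]])
         (simp add: sum_bool_pair output_loop_def loop_delay_def u e matrix_vector_right_distrib tau_def algebra_simps)
  qed
qed

lemma output_loop_trajectory:
  assumes "0 \<le> tcon P" "0 \<le> tcom P"
    and sol: "delay_solution (tau P) (loop_delay P) (output_loop P G1 G2 K1 K2 S1 S2 S3 0) (\<lambda>_. 0) 0 \<phi>"
  shows "\<exists>x z \<xi> u ev. \<phi> = (\<lambda>t. (x t, z t, \<xi> t)) \<and>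
    augmented_system P G1 G2 0 (\<lambda>_. 0) x z u ev \<and> output_feedback P K1 K2 S1 S2 S3 ev z \<xi> u"
proof -
  define x where "x t = fst (\<phi> t)" for t
  define z where "z t = fst (snd (\<phi> t))" for t
  define \<xi> where "\<xi> t = snd (snd (\<phi> t))" for t
  define u where "u t = K1 *v z t + K2 *v \<xi> t" for t
  define ev where "ev t = tilC P 0 *v x t" for t
  have c: "continuous_on {- tau P..0} \<phi>"
    using sol by (auto simp: delay_solution_def elim!: continuous_on_subset)
  have d: "(\<phi> has_vector_derivative (tilA P 0 *v x t + tilB P 0 *v u (t - tcon P),
      (mat 1 \<otimes>\<^sub>k G1) *v z t + (mat 1 \<otimes>\<^sub>k G2) *v ev (t - tcom P),
      S1 *v \<xi> t + S2 *v ev (t - tcom P) + S3 *v col2 (z (t - tau P)) (\<xi> (t - tau P)))) (at t within {0..})"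
    if "0 \<le> t" for t
  proof -
    have "(\<phi> has_vector_derivative (\<Sum>k\<in>UNIV. output_loop P G1 G2 K1 K2 S1 S2 S3 0 k (\<phi> (t - loop_delay P k))) + 0) (at t within {0..})"
      using sol that by (simp add: delay_solution_def)
    then show ?thesis
      by (rule has_vector_derivative_eq_rhs)
         (simp add: sum_bool_pair output_loop_def loop_delay_def tau_def u_def ev_def x_def z_def \<xi>_def algebra_simps)
  qed
  note d_snd = bounded_linear.has_vector_derivative[OF bounded_linear_snd d]
  note d' = bounded_linear.has_vector_derivative[OF bounded_linear_fst d]
    bounded_linear.has_vector_derivative[OF bounded_linear_fst d_snd]
    bounded_linear.has_vector_derivative[OF bounded_linear_snd d_snd]
  have "augmented_system P G1 G2 0 (\<lambda>_. 0) x z u ev"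
    using d' c unfolding augmented_system_def auxiliary_system_def internal_model_dynamics_def exosystem_def error_signal_def
    by (auto simp: x_def[abs_def] z_def[abs_def] ev_def intro!: continuous_intros)
  moreover have "output_feedback P K1 K2 S1 S2 S3 ev z \<xi> u"
    using d' c unfolding output_feedback_def
    by (auto simp: \<xi>_def[abs_def] u_def intro!: continuous_intros)
  moreover have "\<phi> = (\<lambda>t. (x t, z t, \<xi> t))" by (simp add: x_def z_def \<xi>_def)
  ultimately show ?thesis by blast
qed

lemma output_feedback_robust:
  fixes P :: "('N::finite, 'n::finite, 'm::finite, 'p::finite, 'q::finite) plant"
    and G1 :: "real^('p \<times> 'b::finite)^('p \<times> 'b)"
  assumes delays: "0 \<le> tcon P" "0 \<le> tcom P"
    and im: "minimal_p_copy_internal_model (exoS P) G1 G2"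
    and stab: "output_feedback_stabilizes P G1 G2 K1 K2 S1 S2 S3"
  shows "solves_robust_output_regulation P (dynamic_output_feedback P G1 G2 K1 K2 S1 S2 S3)"
proof -
  have nominal: "exp_stable (tau P) {\<lambda>t. (x t, \<eta> t) | x \<eta> u ev.
      auxiliary_system P 0 (\<lambda>_. 0) x u ev \<and> dynamic_output_feedback P G1 G2 K1 K2 S1 S2 S3 x ev \<eta> u}"
  proof (rule exp_stable_subset[OF stab[unfolded output_feedback_stabilizes_def]], safe)
    fix x \<eta> u ev
    assume "auxiliary_system P 0 (\<lambda>_. 0) x u ev" "dynamic_output_feedback P G1 G2 K1 K2 S1 S2 S3 x ev \<eta> u"
    then show "\<exists>x' z \<xi> u ev. (\<lambda>t. (x t, \<eta> t)) = (\<lambda>t. (x' t, z t, \<xi> t)) \<and>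
        augmented_system P G1 G2 0 (\<lambda>_. 0) x' z u ev \<and> output_feedback P K1 K2 S1 S2 S3 ev z \<xi> u"
      by (intro exI[of _ x] exI[of _ "\<lambda>t. fst (\<eta> t)"] exI[of _ "\<lambda>t. snd (\<eta> t)"] exI[of _ u] exI[of _ ev])
         (simp add: augmented_system_def dynamic_output_feedback_def)
  qed
  have stable: "exp_stable (tau P)
      {\<phi>. delay_solution (tau P) (loop_delay P) (output_loop P G1 G2 K1 K2 S1 S2 S3 0) (\<lambda>_. 0) 0 \<phi>}"
    by (rule exp_stable_subset[OF stab[unfolded output_feedback_stabilizes_def]])
       (use output_loop_trajectory[OF delays] in blast)
  obtain W where W: "open W" "0 \<in> W"
    and decay: "\<And>w \<phi> a. w \<in> W \<Longrightarrow>
      delay_solution (tau P) (loop_delay P) (output_loop P G1 G2 K1 K2 S1 S2 S3 w) (\<lambda>_. 0) a \<phi> \<Longrightarrow> (\<phi> \<longlongrightarrow> 0) at_top"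
    using stability_neighbourhood[OF loop_delay_bounds[OF delays] linear_output_loop continuous_output_loop stable] by metis
  have "(ev \<longlongrightarrow> 0) at_top"
    if w: "w \<in> W" and aux: "auxiliary_system P w v x u ev"
      and law: "dynamic_output_feedback P G1 G2 K1 K2 S1 S2 S3 x ev \<eta> u" for w v x \<eta> u ev
  proof (rule loop_regulates[OF delays im _ linear_output_loop decay[OF w] _ _ _ output_loop_solution[OF delays aux law]])
    show "exosystem P v" using aux by (simp add: auxiliary_system_def)
    show "bounded_linear (\<lambda>y. (tilE P w *v y, 0 :: real^('N \<times> ('p \<times> 'b)), 0 :: real^('N \<times> 'n)))"
      "bounded_linear (\<lambda>y. (0 :: real^('N \<times> 'n), (mat 1 \<otimes>\<^sub>k G2) *v (tilF P *v y), S2 *v (tilF P *v y)))"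
      by (auto intro!: bounded_linear_Pair bounded_linear_zero bounded_linear_compose[OF matrix_vector_mul_bounded_linear])
    show "bounded_linear (\<lambda>y :: (real^('N \<times> 'n)) \<times> (real^('N \<times> ('p \<times> 'b))) \<times> (real^('N \<times> 'n)). fst (snd y))"
      by (rule bounded_linear_compose[OF bounded_linear_fst bounded_linear_snd])
    show "internal_model_dynamics P G1 G2 ev (\<lambda>t. fst (snd (x t, \<eta> t)))"
      using law by (simp add: dynamic_output_feedback_def)
  qed
  then show ?thesis unfolding solves_robust_output_regulation_def
    by (intro conjI nominal exI[of _ W] W) blast
qed

section \<open>Robust output regulation of the multi-agent system\<close>

theorem lemma3p1:
  fixes P :: "('N::finite, 'n::finite, 'm::finite, 'p::finite, 'q::finite) plant"
    and G1 :: "real^('p \<times> 'b::finite)^('p \<times> 'b)"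
    and G2 :: "real^'p^('p \<times> 'b)"
    and Kx :: "real^('N \<times> 'n)^('N \<times> 'm)"
    and Kz :: "real^('N \<times> ('p \<times> 'b))^('N \<times> 'm)"
    and K1 :: "real^('N \<times> ('p \<times> 'b))^('N \<times> 'm)"
    and K2 :: "real^('N \<times> 'n)^('N \<times> 'm)"
    and S1 :: "real^('N \<times> 'n)^('N \<times> 'n)"
    and S2 :: "real^('N \<times> 'p)^('N \<times> 'n)"
    and S3 :: "real^(('N \<times> ('p \<times> 'b)) + ('N \<times> 'n))^('N \<times> 'n)"
  assumes delays: "tcon P \<ge> 0" "tcom P \<ge> 0"
    and graph: "weighted_digraph P"
    and internal_model: "minimal_p_copy_internal_model (exoS P) G1 G2"
    and imaginary: "\<And>l. complex_eigenvalue (exoS P) l \<Longrightarrow> Re l = 0"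
  shows
    "(state_feedback_stabilizes P G1 G2 Kx Kz \<longrightarrow>
        solves_robust_output_regulation P (dynamic_state_feedback P G1 G2 Kx Kz) \<and>
        ((\<exists>T. directed_spanning_tree (edges P) T None) \<longrightarrow>
          solves_cooperative_robust_output_regulation P (dynamic_state_feedback P G1 G2 Kx Kz))) \<and>
     (output_feedback_stabilizes P G1 G2 K1 K2 S1 S2 S3 \<longrightarrow>
        solves_robust_output_regulation P (dynamic_output_feedback P G1 G2 K1 K2 S1 S2 S3) \<and>
        ((\<exists>T. directed_spanning_tree (edges P) T None) \<longrightarrow>
          solves_cooperative_robust_output_regulation P
            (dynamic_output_feedback P G1 G2 K1 K2 S1 S2 S3)))"
proof (intro conjI impI; (elim exE)?)
  assume "state_feedback_stabilizes P G1 G2 Kx Kz"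
  then show solves: "solves_robust_output_regulation P (dynamic_state_feedback P G1 G2 Kx Kz)"
    by (rule state_feedback_robust[OF delays internal_model])
  fix T assume "directed_spanning_tree (edges P) T None"
  then show "solves_cooperative_robust_output_regulation P (dynamic_state_feedback P G1 G2 Kx Kz)"
    using solves by (rule cooperative_from_auxiliary[OF delays graph])
next
  assume "output_feedback_stabilizes P G1 G2 K1 K2 S1 S2 S3"
  then show solves: "solves_robust_output_regulation P (dynamic_output_feedback P G1 G2 K1 K2 S1 S2 S3)"
    by (rule output_feedback_robust[OF delays internal_model])
  fix T assume "directed_spanning_tree (edges P) T None"
  then show "solves_cooperative_robust_output_regulation P
      (dynamic_output_feedback P G1 G2 K1 K2 S1 S2 S3)"
    using solves by (rule cooperative_from_auxiliary[OF delays graph])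
qed

end
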